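(* Let $k\in\mathbb{N}$, let $p_1,p_2$ be real numbers with $k\le p_1<p_2<\infty$ and $2k<p_2$, and let $\alpha\in[p_1/p_2,1]$. Then there exists an analytic function $A=A(\alpha)$ in $\mathbb{D}$ such that $\sigma_{M,\deg}(A)=p_2$, $\lambda_{M,\deg}(A)=p_1$, and every non-trivial solution $f$ of $f^{(k)}+Af=0$ in $\mathbb{D}$ satisfies $\sigma_M(f)=p_2/k-1$ and $\lambda_M(f)=p_1/k-\alpha$.
   Context: $\mathbb{D}=\{z\in\mathbb{C}:|z|<1\}$, $\mathbb{N}=\{1,2,\dots\}$, $M(r,g)=\max_{|z|=r}|g(z)|$, and $\log^+x=\max\{\log x,0\}$ (with $\log^+0=0$). For $f$ analytic in $\mathbb{D}$, the order and lower order of growth are $$\sigma_M(f)=\limsup_{r\to1^-}\frac{\log^+\log^+M(r,f)}{\log\frac1{1-r}},\qquad \lambda_M(f)=\liminf_{r\to1^-}\frac{\log^+\log^+M(r,f)}{\log\frac1{1-r}}.$$ For $A$ analytic in $\mathbb{D}$, the degree and lower degree of growth are $$\sigma_{M,\deg}(A)=\limsup_{r\to1^-}\frac{\log^+M(r,A)}{\log\frac1{1-r}},\qquad \lambda_{M,\deg}(A)=\liminf_{r\to1^-}\frac{\log^+M(r,A)}{\log\frac1{1-r}}.$$ Solutions are analytic functions in $\mathbb{D}$; non-trivial means not identically zero. *)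

theory Defs
  imports "HOL-Analysis.Analysis"
begin

abbreviation unit_disc :: "complex set" where
  "unit_disc \<equiv> ball 0 1"

text \<open>For \<open>0 \<le> r < 1\<close> and \<open>g\<close> continuous on the disc the supremum is attained, as the
  circle is compact and nonempty.\<close>

definition max_modulus :: "real \<Rightarrow> (complex \<Rightarrow> complex) \<Rightarrow> real" where
  "max_modulus r g = (SUP z\<in>sphere 0 r. norm (g z))"

text \<open>The convention \<open>log_plus 0 = 0\<close> holds because \<open>ln 0 = 0\<close> in HOL. The argument is always
  nonnegative below.\<close>

definition log_plus :: "real \<Rightarrow> real" where
  "log_plus x = max (ln x) 0"

text \<open>The growth indicators are extended reals, since the limits may be infinite.\<close>

definition growth_order :: "(complex \<Rightarrow> complex) \<Rightarrow> ereal" where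
  "growth_order f =
     Limsup (at_left 1) (\<lambda>r::real. ereal (log_plus (log_plus (max_modulus r f)) / ln (1 / (1 - r))))"

definition lower_growth_order :: "(complex \<Rightarrow> complex) \<Rightarrow> ereal" where
  "lower_growth_order f =
     Liminf (at_left 1) (\<lambda>r::real. ereal (log_plus (log_plus (max_modulus r f)) / ln (1 / (1 - r))))"

definition growth_degree :: "(complex \<Rightarrow> complex) \<Rightarrow> ereal" where
  "growth_degree A =
     Limsup (at_left 1) (\<lambda>r::real. ereal (log_plus (max_modulus r A) / ln (1 / (1 - r))))"

definition lower_growth_degree :: "(complex \<Rightarrow> complex) \<Rightarrow> ereal" where
  "lower_growth_degree A =
     Liminf (at_left 1) (\<lambda>r::real. ereal (log_plus (max_modulus r A) / ln (1 / (1 - r))))"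

text \<open>\<open>f\<close> is a solution of \<open>f\<^sup>(\<^sup>k\<^sup>) + A f = 0\<close> in the unit disc. Values outside the disc play
  no role: the disc is open, so the derivatives at its points depend only on \<open>f\<close> in the disc.\<close>

definition is_solution :: "nat \<Rightarrow> (complex \<Rightarrow> complex) \<Rightarrow> (complex \<Rightarrow> complex) \<Rightarrow> bool" where
  "is_solution k A f \<longleftrightarrow>
     f analytic_on unit_disc \<and> (\<forall>z\<in>unit_disc. (deriv ^^ k) f z + A z * f z = 0)"

definition nontrivial :: "(complex \<Rightarrow> complex) \<Rightarrow> bool" where
  "nontrivial f \<longleftrightarrow> (\<exists>z\<in>unit_disc. f z \<noteq> 0)"

end

theory Submission
  imports Defs "HOL-Complex_Analysis.Complex_Analysis"
begin

text \<open>The coefficient is \<open>A z = (1 - z) powr - p1 + (\<Sum>j. N j powr p2 * z ^ N j)\<close>, where the exponents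
  \<open>N j\<close> grow so fast that \<open>ln (N j) / ln (N (j + 1))\<close> tends to
  \<open>\<kappa> = (p1 / k - \<alpha>) / (p2 / k - 1) \<le> p1 / p2\<close>. The singular part is of size \<open>(1 - r) powr - p1\<close> on every
  circle, and the \<open>j\<close>-th monomial lifts \<open>A\<close> to the size \<open>(1 - r) powr - p2\<close> exactly where
  \<open>1 - r\<close> is about \<open>1 / N j\<close>.

  A solution satisfies \<open>ln \<bar>f z\<bar> \<le> const + W \<bar>z\<bar>\<close> whenever \<open>w = W'\<close> is increasing and
  \<open>\<bar>A z\<bar> \<le> w \<bar>z\<bar> ^ k\<close>; this gives the upper bounds, the one for the lower order being read off just
  before the monomial \<open>j + 1\<close> becomes visible. Conversely, if \<open>ln M(r, f)\<close> were at most
  \<open>N j powr s\<close> with \<open>s < p2 / k - 1\<close> at \<open>r = 1 - 1 / (2 * N j)\<close>, then Cauchy's estimate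
  at a maximum point would bound \<open>A = - f\<^sup>(\<^sup>k\<^sup>) / f\<close> by
  \<open>const * N j powr ((s + 1) * k)\<close>, far below its size there. As \<open>M(r, f)\<close> is increasing, these lower
  bounds at the peaks suffice: between the peaks \<open>j\<close> and \<open>j + 1\<close> they give the lower order \<open>\<kappa> * (p2 / k - 1) = p1 / k - \<alpha>\<close>.\<close>

section \<open>Elementary estimates and the gap sequence\<close>

lemma powr_le_exp:
  fixes u q :: real
  assumes "0 \<le> u" "0 < q"
  shows "u powr q \<le> q powr q * exp u"
proof -
  have "u / q \<le> exp (u / q)"
    using exp_ge_add_one_self[of "u / q"] by linarith
  then have "(u / q) powr q \<le> exp (u / q) powr q"
    using assms by (intro powr_mono2) auto
  also have "\<dots> = exp u"
    using assms by (simp add: powr_def)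
  finally show ?thesis
    using assms by (simp add: powr_divide field_simps)
qed

lemma power_le_exp_one_minus:
  fixes t :: real
  assumes "0 \<le> t"
  shows "t ^ n \<le> exp (- (real n * (1 - t)))"
proof -
  have "t \<le> exp (- (1 - t))"
    using exp_ge_add_one_self[of "- (1 - t)"] by simp
  then have "t ^ n \<le> exp (- (1 - t)) ^ n"
    using assms by (intro power_mono)
  then show ?thesis
    by (simp add: exp_of_nat_mult[symmetric] algebra_simps)
qed

text \<open>With \<open>u = n * (1 - t + \<eta>)\<close> the factor \<open>u powr Q\<close> costs at
  most \<open>Q powr Q * exp u\<close>, and \<open>t ^ n\<close> pays \<open>exp u\<close> back up
  to \<open>exp 1\<close> because \<open>n * \<eta> \<le> 1\<close>. Thus a shift by up to
  \<open>1 / n\<close> is free.\<close>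

lemma powr_times_power_le:
  fixes t \<eta> Q :: real
  assumes "0 < n" "0 \<le> t" "t \<le> 1" "0 \<le> \<eta>" "\<eta> \<le> 1 / real n" "0 < Q" "0 < 1 - t + \<eta>"
  shows "real n powr Q * t ^ n \<le> exp 1 * Q powr Q * (1 - t + \<eta>) powr (- Q)"
proof -
  define u where "u = real n * (1 - t + \<eta>)"
  have "0 \<le> real n * (1 - t + \<eta>)"
    using assms by (intro mult_nonneg_nonneg) auto
  then have u: "0 \<le> u" "u \<le> real n * (1 - t) + 1"
    using assms by (auto simp: u_def field_simps)
  have "real n powr Q * (1 - t + \<eta>) powr Q = u powr Q"
    using assms by (simp add: u_def powr_mult)
  also have "\<dots> \<le> Q powr Q * exp u"
    using u assms by (intro powr_le_exp)
  also have "\<dots> \<le> Q powr Q * exp (real n * (1 - t) + 1)"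
    using u by (intro mult_left_mono) auto
  finally have "real n powr Q * (1 - t + \<eta>) powr Q * t ^ n
      \<le> Q powr Q * exp (real n * (1 - t) + 1) * exp (- (real n * (1 - t)))"
    using power_le_exp_one_minus[of t n] assms by (intro mult_mono[of "_ * _"]) auto
  also have "\<dots> = exp 1 * Q powr Q"
    by (simp add: exp_add[symmetric] mult.assoc)
  finally show ?thesis
    using assms by (simp add: powr_minus field_simps)
qed

text \<open>Stretched exponential decay absorbs every power of \<open>x\<close>; this handles the
  monomials not yet visible at a given radius.\<close>

lemma powr_times_exp_le:
  fixes c \<eta> q x :: real
  assumes "0 < c" "0 < \<eta>" "0 < q" "0 < x"
  shows "x powr q * exp (- (c * x powr \<eta>)) \<le> (q / \<eta>) powr (q / \<eta>) / c powr (q / \<eta>)"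
proof -
  have "(c * x powr \<eta>) powr (q / \<eta>) \<le> (q / \<eta>) powr (q / \<eta>) * exp (c * x powr \<eta>)"
    using assms by (intro powr_le_exp) auto
  then have "c powr (q / \<eta>) * x powr q \<le> (q / \<eta>) powr (q / \<eta>) * exp (c * x powr \<eta>)"
    using assms by (simp add: powr_mult powr_powr)
  then show ?thesis
    using assms by (simp add: exp_minus field_simps)
qed

text \<open>At radius \<open>1 - 1 / n\<close> the monomial of degree \<open>n\<close> has lost only
  a constant factor. The second-order bound on the logarithm gives the exponent
  \<open>- 1 - 2 / n\<close>, which is at least \<open>- 2\<close>.\<close>

lemma one_minus_inverse_power_ge:
  assumes "2 \<le> n"
  shows "exp (- 2) \<le> (1 - 1 / real n) ^ n"
proof -
  have "- (1 / real n) - 2 * (1 / real n)\<^sup>2 \<le> ln (1 - 1 / real n)"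
    using assms by (intro ln_one_minus_pos_lower_bound) (auto simp: field_simps)
  then have "real n * (- (1 / real n) - 2 * (1 / real n)\<^sup>2) \<le> real n * ln (1 - 1 / real n)"
    by (intro mult_left_mono) auto
  moreover have "real n * (- (1 / real n) - 2 * (1 / real n)\<^sup>2) = - 1 - 2 / real n"
    using assms by (simp add: field_simps power2_eq_square)
  moreover have "2 / real n \<le> 1"
    using assms by simp
  ultimately have "- 2 \<le> real n * ln (1 - 1 / real n)"
    by linarith
  then have "exp (- 2) \<le> exp (real n * ln (1 - 1 / real n))"
    by (simp only: exp_le_cancel_iff)
  also have "\<dots> = (1 - 1 / real n) ^ n"
    using assms by (simp add: exp_of_nat_mult)
  finally show ?thesis .
qed

text \<open>Each exponent is the previous one raised to \<open>1 / \<kappa>' j\<close>, rounded up,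
  where \<open>\<kappa>' j\<close> tends to \<open>\<kappa>\<close>. Rounding costs at most a factor
  2, hence an error of at most \<open>ln 2 / ln (N (Suc j))\<close> in the quotient of logarithms,
  which vanishes.\<close>

lemma exists_gap_sequence:
  fixes \<kappa> q :: real
  assumes "0 \<le> \<kappa>" "\<kappa> \<le> q" "0 < q" "q < 1"
  obtains N :: "nat \<Rightarrow> nat" where "\<And>j. 2 \<le> N j" "\<And>j. 2 * N j \<le> N (Suc j)"
    "\<And>j. real (N j) \<le> real (N (Suc j)) powr q"
    "(\<lambda>j. ln (N j) / ln (N (Suc j))) \<longlonglongrightarrow> \<kappa>"
proof -
  \<comment> \<open>For \<open>\<kappa> = 0\<close> the exponent \<open>1 / \<kappa>\<close> makes
    no sense; the second entry of the maximum keeps \<open>\<kappa>' j\<close> positive, and it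
    tends to 0.\<close>
  define \<kappa>' where "\<kappa>' j = max \<kappa> (q / real (Suc j))" for j
  have \<kappa>'_pos: "0 < \<kappa>' j" and \<kappa>'_le: "\<kappa>' j \<le> q" for j
    using assms by (auto simp: \<kappa>'_def field_simps less_max_iff_disj)
  \<comment> \<open>As \<open>1 / q = 1 + e\<close>, an exponent with
    \<open>N j powr e \<ge> 2\<close> at least doubles in one step. This is why \<open>N 0\<close>
    starts above \<open>2 powr (1 / e)\<close>.\<close>
  define e where "e = 1 / q - 1"
  have e: "0 < e"
    using assms by (simp add: e_def)
  define N where "N = rec_nat (nat \<lceil>2 powr (1 / e)\<rceil> + 2)
    (\<lambda>j n. nat \<lceil>real n powr (1 / \<kappa>' j)\<rceil>)"
  have N0: "N 0 = nat \<lceil>2 powr (1 / e)\<rceil> + 2"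
    and NS: "N (Suc j) = nat \<lceil>real (N j) powr (1 / \<kappa>' j)\<rceil>" for j
    by (simp_all add: N_def)
  have NS_ge: "real (N j) powr (1 / \<kappa>' j) \<le> real (N (Suc j))" for j
    unfolding NS by linarith
  have step: "real (N j) powr (1 / q) \<le> real (N (Suc j)) \<and> 2 * N j \<le> N (Suc j)"
    if "2 \<le> N j" "2 powr (1 / e) \<le> real (N j)" for j
  proof -
    have "1 / q \<le> 1 / \<kappa>' j"
      using \<kappa>'_pos[of j] \<kappa>'_le[of j] assms by (intro divide_left_mono) auto
    then have "real (N j) powr (1 / q) \<le> real (N j) powr (1 / \<kappa>' j)"
      using that by (intro powr_mono) auto
    with NS_ge[of j] have A: "real (N j) powr (1 / q) \<le> real (N (Suc j))"
      by linarith
    have "(2 powr (1 / e)) powr e \<le> real (N j) powr e"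
      using that e by (intro powr_mono2) auto
    then have "2 \<le> real (N j) powr e"
      using e by (simp add: powr_powr)
    then have "real (N j) * 2 \<le> real (N j) * real (N j) powr e"
      by (intro mult_left_mono) auto
    also have "\<dots> = real (N j) powr (1 / q)"
      using that by (simp add: e_def powr_diff)
    finally show ?thesis
      using A by linarith
  qed
  have inv: "2 \<le> N j \<and> 2 powr (1 / e) \<le> real (N j)" for j
  proof (induction j)
    case 0
    show ?case unfolding N0 by linarith
  next
    case (Suc j)
    with step[of j] show ?case by linarith
  qed
  have ge2: "2 \<le> N j" for j using inv by blast
  have dbl: "2 * N j \<le> N (Suc j)" for j using step inv by blast
  have gap: "real (N j) \<le> real (N (Suc j)) powr q" for j
  proof -
    have "(real (N j) powr (1 / q)) powr q \<le> real (N (Suc j)) powr q"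
      using step[of j] inv[of j] assms by (intro powr_mono2) auto
    then show ?thesis
      using assms ge2[of j] by (simp add: powr_powr)
  qed
  have N_pow: "2 ^ j \<le> N j" for j
    by (induction j) (use ge2[of 0] dbl in \<open>auto intro: order.trans[OF _ dbl]\<close>)
  have "filterlim (\<lambda>j. 2 ^ j :: real) at_top sequentially"
    by real_asymp
  moreover have "\<forall>\<^sub>F j in sequentially. 2 ^ j \<le> real (N j)"
    using N_pow by (metis (mono_tags, lifting) always_eventually of_nat_le_iff of_nat_numeral of_nat_power)
  ultimately have Ninf: "filterlim (\<lambda>j. real (N j)) at_top sequentially"
    by (rule filterlim_at_top_mono)
  then have "filterlim (\<lambda>j. ln (real (N (Suc j)))) at_top sequentially"
    using filterlim_compose[OF ln_at_top] filterlim_sequentially_Suc[of "\<lambda>j. real (N j)"] by blast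
  then have err0: "(\<lambda>j. ln 2 / ln (real (N (Suc j)))) \<longlonglongrightarrow> 0"
    by (rule tendsto_divide_0[OF tendsto_const filterlim_at_top_imp_at_infinity])
  have "(\<lambda>j. q / real (Suc j)) \<longlonglongrightarrow> 0"
    by real_asymp
  then have "\<kappa>' \<longlonglongrightarrow> max \<kappa> 0"
    unfolding \<kappa>'_def by (intro tendsto_max tendsto_const)
  then have \<kappa>'_lim: "\<kappa>' \<longlonglongrightarrow> \<kappa>"
    using assms by simp
  have divide_bounds: "k - l / y \<le> x / y \<and> x / y \<le> k" if "k * y - l \<le> x" "x \<le> k * y" "0 < y"
    for k l x y :: real
  proof -
    have "k - l / y = (k * y - l) / y"
      using that by (simp add: diff_divide_distrib)
    also have "\<dots> \<le> x / y"
      using that by (intro divide_right_mono) auto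
    finally show ?thesis
      using that by (simp add: pos_divide_le_eq)
  qed
  have bounds: "\<kappa>' j - ln 2 / ln (N (Suc j)) \<le> ln (N j) / ln (N (Suc j)) \<and>
      ln (N j) / ln (N (Suc j)) \<le> \<kappa>' j" for j
  proof -
    let ?x = "real (N j) powr (1 / \<kappa>' j)"
    have x1: "1 \<le> ?x"
      using ge2[of j] \<kappa>'_pos[of j] by (intro ge_one_powr_ge_zero) auto
    have L: "ln ?x = ln (N j) / \<kappa>' j"
      using ge2[of j] by (simp add: ln_powr)
    have pos: "0 < ln (real (N (Suc j)))"
      using ge2[of "Suc j"] by simp
    have "ln ?x \<le> ln (N (Suc j))"
      using NS_ge[of j] x1 by (subst ln_le_cancel_iff) linarith+
    then have up: "ln (N j) \<le> \<kappa>' j * ln (N (Suc j))"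
      unfolding L using \<kappa>'_pos[of j] by (simp add: field_simps)
    have "real (N (Suc j)) \<le> 2 * ?x"
      unfolding NS using x1 by linarith
    then have "ln (N (Suc j)) \<le> ln (2 * ?x)"
      using ge2[of "Suc j"] by (intro ln_mono) auto
    also have "\<dots> = ln 2 + ln (N j) / \<kappa>' j"
      using x1 L ge2[of j] by (subst ln_mult) auto
    finally have "\<kappa>' j * ln (N (Suc j)) \<le> \<kappa>' j * ln 2 + ln (N j)"
      using \<kappa>'_pos[of j] by (simp add: field_simps)
    moreover have "\<kappa>' j * ln 2 \<le> 1 * ln 2"
      using \<kappa>'_le[of j] assms by (intro mult_right_mono) auto
    ultimately have "\<kappa>' j * ln (N (Suc j)) - ln 2 \<le> ln (N j)"
      by linarith
    with up pos show ?thesis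
      by (intro divide_bounds)
  qed
  have lower: "(\<lambda>j. \<kappa>' j - ln 2 / ln (N (Suc j))) \<longlonglongrightarrow> \<kappa>"
    using tendsto_diff[OF \<kappa>'_lim err0] by simp
  have "(\<lambda>j. ln (N j) / ln (N (Suc j))) \<longlonglongrightarrow> \<kappa>"
    by (rule tendsto_sandwich[OF _ _ lower \<kappa>'_lim])
      (intro always_eventually allI conjunct1[OF bounds] conjunct2[OF bounds])+
  with ge2 dbl gap show thesis by (rule that)
qed

section \<open>Limits superior and inferior from bounds up to epsilon\<close>

lemma Limsup_ereal_le:
  fixes f :: "'a \<Rightarrow> real"
  assumes "\<And>e. 0 < e \<Longrightarrow> \<forall>\<^sub>F x in F. f x \<le> c + e"
  shows "Limsup F (\<lambda>x. ereal (f x)) \<le> ereal c"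
proof (rule ereal_le_epsilon2)
  fix e :: real assume "0 < e"
  then show "Limsup F (\<lambda>x. ereal (f x)) \<le> ereal c + ereal e"
    using assms[of e] by (intro Limsup_bounded) simp
qed

lemma Liminf_ereal_ge:
  fixes f :: "'a \<Rightarrow> real"
  assumes "\<And>e. 0 < e \<Longrightarrow> \<forall>\<^sub>F x in F. c - e \<le> f x"
  shows "ereal c \<le> Liminf F (\<lambda>x. ereal (f x))"
proof (rule ereal_le_epsilon2)
  fix e :: real assume "0 < e"
  then have "ereal (c - e) \<le> Liminf F (\<lambda>x. ereal (f x))"
    using assms[of e] by (intro Liminf_bounded) simp
  then have "ereal (c - e) + ereal e \<le> Liminf F (\<lambda>x. ereal (f x)) + ereal e"
    by (rule add_right_mono)
  then show "ereal c \<le> Liminf F (\<lambda>x. ereal (f x)) + ereal e"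
    by simp
qed

lemma Limsup_ereal_ge:
  fixes f :: "'a \<Rightarrow> real"
  assumes "filterlim r F sequentially"
    and "\<And>e. 0 < e \<Longrightarrow> \<forall>\<^sub>F j in sequentially. c - e \<le> f (r j)"
  shows "ereal c \<le> Limsup F (\<lambda>x. ereal (f x))"
proof (rule Limsup_greatest)
  fix P assume "eventually P F"
  then have P: "\<forall>\<^sub>F j in sequentially. P (r j)"
    using assms(1) by (rule eventually_compose_filterlim)
  show "ereal c \<le> (SUP x\<in>Collect P. ereal (f x))"
  proof (rule ereal_le_epsilon2)
    fix e :: real assume "0 < e"
    then obtain j where j: "P (r j)" "c - e \<le> f (r j)"
      using eventually_happens[OF eventually_conj[OF P assms(2)]] by auto
    have "ereal c \<le> ereal (f (r j)) + ereal e"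
      using j by simp
    also have "\<dots> \<le> (SUP x\<in>Collect P. ereal (f x)) + ereal e"
      using j by (intro add_right_mono SUP_upper) auto
    finally show "ereal c \<le> (SUP x\<in>Collect P. ereal (f x)) + ereal e" .
  qed
qed

text \<open>The sequence may depend on \<open>e\<close>: the radii used later lie just before the
  peaks, and how far before is chosen from the tolerance. Negation reduces the claim to
  \<open>Limsup_ereal_ge\<close>.\<close>

lemma Liminf_ereal_le:
  fixes f :: "'a \<Rightarrow> real"
  assumes "\<And>e. 0 < e \<Longrightarrow> \<exists>r. filterlim r F sequentially \<and> (\<forall>\<^sub>F j in sequentially. f (r j) \<le> c + e)"
  shows "Liminf F (\<lambda>x. ereal (f x)) \<le> ereal c"
proof (rule ereal_le_epsilon2)
  fix e :: real assume "0 < e"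
  then obtain r where r: "filterlim r F sequentially" "\<forall>\<^sub>F j in sequentially. f (r j) \<le> c + e"
    using assms by blast
  have "\<forall>\<^sub>F j in sequentially. - (c + e) - e' \<le> - f (r j)" if "0 < e'" for e'
    using r(2) by (rule eventually_mono) (use that in simp)
  then have "ereal (- (c + e)) \<le> Limsup F (\<lambda>x. ereal (- f x))"
    by (rule Limsup_ereal_ge[OF r(1)])
  then have "- Limsup F (\<lambda>x. ereal (- f x)) \<le> ereal (c + e)"
    by (metis ereal_uminus_le_reorder uminus_ereal.simps(1))
  then show "Liminf F (\<lambda>x. ereal (f x)) \<le> ereal c + ereal e"
    by (simp add: ereal_Limsup_uminus flip: uminus_ereal.simps)
qed

section \<open>Logarithms near the boundary and small parameters\<close>

lemma log_plus_le: "0 \<le> v \<Longrightarrow> v \<le> w \<Longrightarrow> 1 \<le> w \<Longrightarrow> log_plus v \<le> ln w"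
  by (cases "v = 0") (auto simp: log_plus_def)

lemma log_plus_ge: "0 < w \<Longrightarrow> w \<le> v \<Longrightarrow> ln w \<le> log_plus v"
  by (simp add: log_plus_def le_max_iff_disj)

lemma log_plus_nonneg: "0 \<le> log_plus v"
  by (simp add: log_plus_def)

lemma filterlim_ln_inverse_one_minus: "filterlim (\<lambda>r::real. ln (1 / (1 - r))) at_top (at_left 1)"
  by real_asymp

lemma filterlim_one_minus_inverse:
  fixes g :: "'a \<Rightarrow> real"
  assumes "filterlim g at_top F"
  shows "filterlim (\<lambda>x. 1 - 1 / g x) (at_left 1) F"
proof -
  have "filterlim (\<lambda>x::real. 1 - 1 / x) (at_left 1) at_top"
    by real_asymp
  then show ?thesis
    using assms by (rule filterlim_compose)
qed

lemma eventually_ge_multiple_at_left_1: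
  assumes "0 < e"
  shows "\<forall>\<^sub>F r::real in at_left 1. 0 < r \<and> r < 1 \<and> 0 < ln (1 / (1 - r)) \<and> B \<le> e * ln (1 / (1 - r))"
proof -
  have "\<forall>\<^sub>F r::real in at_left 1. max 1 (B / e) \<le> ln (1 / (1 - r))"
    using filterlim_ln_inverse_one_minus by (simp only: filterlim_at_top)
  moreover have "\<forall>\<^sub>F r::real in at_left 1. 0 < r \<and> r < 1"
    by (subst eventually_at_left[of 0]) (auto intro!: exI[of _ 0])
  ultimately show ?thesis
  proof eventually_elim
    case (elim r)
    then have "e * (B / e) \<le> e * ln (1 / (1 - r))"
      using assms by (intro mult_left_mono) auto
    then show ?case
      using elim assms by auto
  qed
qed

text \<open>Along the chosen radii the growth quotients are compared with quotients affine in the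
  logarithm of an exponent, so only the slopes survive.\<close>

lemma affine_ratio_tendsto:
  fixes L :: "'a \<Rightarrow> real"
  assumes "filterlim L at_top F" "0 < d"
  shows "((\<lambda>x. (c + m * L x) / (b + d * L x)) \<longlongrightarrow> m / d) F"
proof -
  have inv: "((\<lambda>x. y / L x) \<longlongrightarrow> 0) F" for y
    by (rule tendsto_divide_0[OF tendsto_const filterlim_at_top_imp_at_infinity[OF assms(1)]])
  have "((\<lambda>x. (c / L x + m) / (b / L x + d)) \<longlongrightarrow> (0 + m) / (0 + d)) F"
    using assms by (intro tendsto_divide tendsto_add inv tendsto_const) auto
  moreover have "\<forall>\<^sub>F x in F. (c / L x + m) / (b / L x + d) = (c + m * L x) / (b + d * L x)"
  proof -
    have "\<forall>\<^sub>F x in F. 0 < L x"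
      using assms(1) by (simp add: filterlim_at_top_dense)
    then show ?thesis
    proof eventually_elim
      case (elim x)
      have "(c / L x + m) / (b / L x + d) = ((c / L x + m) * L x) / ((b / L x + d) * L x)"
        using elim by (intro mult_divide_mult_cancel_right[symmetric]) auto
      also have "(c / L x + m) * L x = c + m * L x"
        using elim by (simp add: distrib_right)
      also have "(b / L x + d) * L x = b + d * L x"
        using elim by (simp add: distrib_right)
      finally show ?case .
    qed
  qed
  ultimately show ?thesis
    by (simp add: tendsto_cong)
qed

text \<open>Used to pick a perturbation \<open>x\<close> of the exponents for which the resulting
  growth rate exceeds the ideal rate \<open>g 0\<close> by less than \<open>e\<close>.\<close>

lemma isCont_exists_less:
  fixes g :: "real \<Rightarrow> real"
  assumes "isCont g 0" "0 < e"
  obtains x where "0 < x" "x < 1" "g x < g 0 + e"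
proof -
  have "(g \<longlongrightarrow> g 0) (at_right 0)"
    using assms(1) by (simp add: isCont_def filterlim_at_split)
  then have "\<forall>\<^sub>F x in at_right 0. g x < g 0 + e"
    using assms(2) by (intro order_tendstoD(2)) auto
  moreover have "\<forall>\<^sub>F x::real in at_right 0. x \<in> {0<..<1}"
    by (rule eventually_at_right_real) simp
  ultimately have "\<forall>\<^sub>F x in at_right 0. g x < g 0 + e \<and> x \<in> {0<..<1}"
    by (rule eventually_conj)
  then obtain x where "g x < g 0 + e \<and> x \<in> {0<..<1}"
    using eventually_happens' trivial_limit_at_right_real by blast
  then show thesis
    using that by auto
qed

text \<open>The comparison for solutions wants \<open>A\<close> dominated by the k-th power of a
  single weight. Superadditivity of the k-th power and \<open>C \<le> C ^ k\<close> bring a sum of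
  two terms into that form.\<close>

lemma mult_power_sum_le:
  fixes C x y :: real
  assumes "1 \<le> k" "1 \<le> C" "0 \<le> x" "0 \<le> y"
  shows "C * (x ^ k + y ^ k) \<le> (C * (x + y)) ^ k"
proof -
  have "x ^ k + y ^ k \<le> (x + y) ^ k"
    using \<open>1 \<le> k\<close>
  proof (induction k rule: dec_induct)
    case (step k)
    have "x ^ Suc k + y ^ Suc k \<le> (x + y) * (x ^ k + y ^ k)"
      using assms by (simp add: algebra_simps)
    also have "\<dots> \<le> (x + y) * (x + y) ^ k"
      using step assms by (intro mult_left_mono) auto
    finally show ?case
      by simp
  qed simp
  moreover have "C \<le> C ^ k"
    using assms by (simp add: self_le_power)
  ultimately show ?thesis
    unfolding power_mult_distrib using assms by (intro mult_mono) auto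
qed

section \<open>Growth of solutions\<close>

lemma norm_le_max_modulus:
  assumes "continuous_on (sphere 0 r) g" "norm z = r"
  shows "norm (g z) \<le> max_modulus r g"
  unfolding max_modulus_def
proof (rule cSUP_upper)
  show "z \<in> sphere 0 r"
    using assms by simp
  have "compact ((\<lambda>z. norm (g z)) ` sphere 0 r)"
    using assms by (intro compact_continuous_image continuous_intros) auto
  then show "bdd_above ((\<lambda>z. norm (g z)) ` sphere 0 r)"
    by (intro bounded_imp_bdd_above compact_imp_bounded)
qed

lemma max_modulus_le:
  assumes "0 \<le> r" "\<And>z. norm z = r \<Longrightarrow> norm (g z) \<le> b"
  shows "max_modulus r g \<le> b"
  unfolding max_modulus_def
proof (rule cSUP_least)
  show "sphere (0::complex) r \<noteq> {}"
    using assms by (simp add: sphere_eq_empty)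
qed (use assms in auto)

lemma max_modulus_attained:
  assumes "continuous_on (sphere 0 r) g" "0 \<le> r"
  obtains z where "norm z = r" "norm (g z) = max_modulus r g"
proof -
  have "sphere (0::complex) r \<noteq> {}"
    using assms by (simp add: sphere_eq_empty)
  then obtain z where z: "z \<in> sphere 0 r" "\<forall>w\<in>sphere 0 r. norm (g w) \<le> norm (g z)"
    using continuous_attains_sup[of "sphere 0 r" "\<lambda>z. norm (g z)"] assms(1)
    by (auto simp: continuous_on_norm)
  have "max_modulus r g \<le> norm (g z)"
    using z assms by (intro max_modulus_le) auto
  moreover have "norm (g z) \<le> max_modulus r g"
    using z assms by (intro norm_le_max_modulus) auto
  ultimately show thesis
    using that z by auto
qed

lemma norm_le_max_modulus_cball:
  assumes "f holomorphic_on unit_disc" "r < 1" "norm z \<le> r"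
  shows "norm (f z) \<le> max_modulus r f"
proof (rule maximum_modulus_frontier[of f "cball 0 r"])
  have sub: "cball 0 r \<subseteq> unit_disc"
    using assms by auto
  then have cont: "continuous_on (cball 0 r) f"
    using assms holomorphic_on_imp_continuous_on continuous_on_subset by blast
  then show "continuous_on (closure (cball 0 r)) f"
    by simp
  show "f holomorphic_on interior (cball 0 r)"
    using sub assms interior_subset holomorphic_on_subset by blast
  show "norm (f w) \<le> max_modulus r f" if "w \<in> frontier (cball 0 r)" for w
  proof (rule norm_le_max_modulus)
    show "continuous_on (sphere 0 r) f"
      using cont sphere_cball continuous_on_subset by blast
    show "norm w = r"
      using that by (simp add: frontier_cball)
  qed
qed (use assms in auto)

lemma max_modulus_mono:
  assumes "f holomorphic_on unit_disc" "0 \<le> r" "r \<le> s" "s < 1"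
  shows "max_modulus r f \<le> max_modulus s f"
  using assms by (intro max_modulus_le norm_le_max_modulus_cball) auto

lemma max_modulus_nonneg:
  assumes "f holomorphic_on unit_disc" "0 \<le> r" "r < 1"
  shows "0 \<le> max_modulus r f"
  using norm_le_max_modulus_cball[of f r 0] assms norm_ge_zero[of "f 0"]
  by (metis norm_zero order_trans)

text \<open>A first-exit argument: at the first parameter where some bound becomes an equality, integrating
  the strict inequalities valid before it gives a contradiction.\<close>

lemma vector_barrier:
  fixes g g' :: "nat \<Rightarrow> real \<Rightarrow> 'a::real_normed_vector" and H H' :: "nat \<Rightarrow> real \<Rightarrow> real"
  assumes g: "\<And>i t. i < k \<Longrightarrow> t \<in> {0..R} \<Longrightarrow> (g i has_vector_derivative g' i t) (at t)"
    and H: "\<And>i t. i < k \<Longrightarrow> t \<in> {0..R} \<Longrightarrow> (H i has_vector_derivative H' i t) (at t)"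
    and init: "\<And>i. i < k \<Longrightarrow> norm (g i 0) < H i 0"
    and step: "\<And>i t. i < k \<Longrightarrow> t \<in> {0..R} \<Longrightarrow> (\<And>j. j < k \<Longrightarrow> norm (g j t) \<le> H j t)
        \<Longrightarrow> norm (g' i t) \<le> H' i t"
    and "i < k" "t \<in> {0..R}"
  shows "norm (g i t) < H i t"
proof (rule ccontr)
  assume not: "\<not> norm (g i t) < H i t"
  define S where "S = (\<Union>j\<in>{..<k}. {s \<in> {0..R}. H j s \<le> norm (g j s)})"
  have contg: "continuous_on {0..R} (g j)" and contH: "continuous_on {0..R} (H j)" if "j < k" for j
    using g[OF that] H[OF that] has_vector_derivative_continuous
    by (blast intro: continuous_at_imp_continuous_on)+
  have "closed {s \<in> {0..R}. H j s \<le> norm (g j s)}" if "j < k" for j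
    using contg[OF that] contH[OF that]
    by (intro continuous_on_closed_Collect_le continuous_intros) auto
  then have "closed S"
    unfolding S_def by (intro closed_UN) auto
  moreover have "S \<subseteq> {0..R}"
    by (auto simp: S_def)
  ultimately have comp: "compact S"
    by (metis compact_Icc compact_Int_closed inf.absorb_iff2)
  have "t \<in> S"
    using not assms(5,6) by (force simp: S_def not_less)
  then obtain T where T: "T \<in> S" "\<And>s. s \<in> S \<Longrightarrow> T \<le> s"
    using compact_attains_inf[OF comp] by blast
  then obtain j where j: "j < k" "T \<in> {0..R}" "H j T \<le> norm (g j T)"
    by (auto simp: S_def)
  have "T \<noteq> 0"
    using init[OF j(1)] j by auto
  then have T0: "0 < T"
    using j by auto
  have below: "norm (g l s) \<le> H l s" if "l < k" "s \<in> {0..<T}" for l s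
    using T(2)[of s] that j by (force simp: S_def)
  have sub: "{0..T} \<subseteq> {0..R}"
    using j by auto
  have "norm (g j T - g j 0) \<le> H j T - H j 0"
  proof (rule differentiable_bound_general[OF T0])
    show "continuous_on {0..T} (g j)" "continuous_on {0..T} (H j)"
      using contg contH j sub continuous_on_subset by blast+
    fix s assume s: "0 < s" "s < T"
    show "(g j has_vector_derivative g' j s) (at s)" "(H j has_vector_derivative H' j s) (at s)"
      using g H j s by auto
    show "norm (g' j s) \<le> H' j s"
      using j s below by (intro step) auto
  qed
  moreover have "norm (g j T) \<le> norm (g j T - g j 0) + norm (g j 0)"
    by (rule norm_triangle_sub[of "g j T" "g j 0", THEN order.trans]) simp
  ultimately show False
    using init[OF j(1)] j by linarith
qed

section \<open>Upper and lower bounds for a single solution\<close>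

lemma solution_holomorphic:
  "is_solution k A f \<Longrightarrow> f holomorphic_on unit_disc"
  by (simp add: is_solution_def analytic_imp_holomorphic)

text \<open>Along the ray through \<open>z\<close> the derivatives of order \<open>i < k\<close> are
  compared with \<open>H i t = C * w t ^ i * exp (W t)\<close>. Since \<open>W' = w\<close> and
  \<open>w' \<ge> 0\<close>, the derivative of \<open>H i\<close> is at least
  \<open>H (Suc i)\<close>; for the last component the equation gives the bound
  \<open>w ^ k * H 0 = H k\<close>, so the system of inequalities closes.\<close>

lemma solution_norm_le:
  assumes "1 \<le> k" and sol: "is_solution k A f" and "R < 1"
    and w: "\<And>t. t \<in> {0..R} \<Longrightarrow> (w has_real_derivative w' t) (at t)"
      "\<And>t. t \<in> {0..R} \<Longrightarrow> 0 \<le> w' t" "\<And>t. t \<in> {0..R} \<Longrightarrow> 1 \<le> w t"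
    and W: "\<And>t. t \<in> {0..R} \<Longrightarrow> (W has_real_derivative w t) (at t)" "0 \<le> W 0"
    and A: "\<And>z. norm z \<le> R \<Longrightarrow> norm (A z) \<le> w (norm z) ^ k"
    and z: "norm z \<le> R"
  shows "norm (f z) \<le> (1 + (\<Sum>i<k. norm ((deriv ^^ i) f 0))) * exp (W (norm z))"
proof -
  \<comment> \<open>The summand 1 makes the initial inequalities strict, as
    \<open>vector_barrier\<close> requires; \<open>w 0 \<ge> 1\<close> and
    \<open>W 0 \<ge> 0\<close> then give \<open>C \<le> H i 0\<close>.\<close>
  define C where "C = 1 + (\<Sum>i<k. norm ((deriv ^^ i) f 0))"
  have C: "0 < C" and C_gt: "norm ((deriv ^^ i) f 0) < C" if "i < k" for i
    using member_le_sum[of i "{..<k}" "\<lambda>i. norm ((deriv ^^ i) f 0)"] that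
      sum_nonneg[of "{..<k}" "\<lambda>i. norm ((deriv ^^ i) f 0)"]
    by (auto simp: C_def)
  obtain u :: complex where u: "norm u = 1" "z = of_real (norm z) * u"
  proof (cases "z = 0")
    case False
    then show ?thesis
      by (intro that[of "z / of_real (norm z)"]) (auto simp: norm_divide)
  qed (use that[of 1] in auto)
  define H where "H i t = C * w t ^ i * exp (W t)" for i t
  define H' where "H' i t = C * (real i * w t ^ (i - 1) * w' t) * exp (W t)
      + C * w t ^ i * (exp (W t) * w t)" for i t
  define g where "g i t = (deriv ^^ i) f (of_real t * u)" for i and t :: real
  have R: "norm (of_real t * u) = t" "of_real t * u \<in> unit_disc" if "t \<in> {0..R}" for t
    using that u \<open>R < 1\<close> by (auto simp: norm_mult)
  have "norm (g 0 (norm z)) < H 0 (norm z)"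
  proof (rule vector_barrier[where g = g and H = H and g' = "\<lambda>i t. u * g (Suc i) t" and H' = H' and k = k and R = R])
    fix i t assume i: "i < k" and t: "t \<in> {0..R}"
    have "(deriv ^^ i) f holomorphic_on unit_disc"
      using solution_holomorphic[OF sol] by (intro holomorphic_higher_deriv) auto
    then have "((deriv ^^ i) f has_field_derivative (deriv ^^ Suc i) f (of_real t * u))
        (at (of_real t * u))"
      using holomorphic_derivI[OF _ open_ball] R[OF t] by simp
    moreover have "((\<lambda>t. of_real t * u) has_vector_derivative u) (at t)"
      by (auto intro!: derivative_eq_intros)
    ultimately show "(g i has_vector_derivative u * g (Suc i) t) (at t)"
      using field_vector_diff_chain_at[of "\<lambda>t. of_real t * u" u t "(deriv ^^ i) f"]
      by (simp add: g_def[abs_def] o_def)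
    show "(H i has_vector_derivative H' i t) (at t)"
      unfolding H_def[abs_def] H'_def has_real_derivative_iff_has_vector_derivative[symmetric]
      by (auto intro!: derivative_eq_intros w W t simp: algebra_simps)
    assume le: "\<And>j. j < k \<Longrightarrow> norm (g j t) \<le> H j t"
    have wt: "1 \<le> w t"
      using w t by blast
    have "0 \<le> C * (real i * w t ^ (i - 1) * w' t) * exp (W t)"
      using C[OF i] w(2)[OF t] wt by (intro mult_nonneg_nonneg) auto
    then have H'_ge: "H (Suc i) t \<le> H' i t"
      by (simp add: H_def H'_def algebra_simps)
    have "norm (g (Suc i) t) \<le> H (Suc i) t"
    proof (cases "Suc i < k")
      case False
      then have k: "Suc i = k"
        using i by simp
      have "(deriv ^^ k) f (of_real t * u) = - (A (of_real t * u) * f (of_real t * u))"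
        using sol R[OF t] by (simp add: is_solution_def eq_neg_iff_add_eq_0)
      then have "norm (g k t) = norm (A (of_real t * u)) * norm (g 0 t)"
        by (simp add: g_def norm_mult)
      also have "\<dots> \<le> w t ^ k * H 0 t"
        using A[of "of_real t * u"] R[OF t] t le[of 0] wt \<open>1 \<le> k\<close> by (intro mult_mono) auto
      also have "\<dots> = H k t"
        by (simp add: H_def)
      finally show ?thesis
        unfolding k .
    qed (use le in blast)
    then show "norm (u * g (Suc i) t) \<le> H' i t"
      using H'_ge u by (simp add: norm_mult)
  next
    fix i assume i: "i < k"
    have "0 \<le> R"
      using z norm_ge_zero[of z] by linarith
    then have "1 \<le> w 0 ^ i"
      using w by (intro one_le_power) auto
    then have "C * 1 * 1 \<le> C * w 0 ^ i * exp (W 0)"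
      using W C[OF i] by (intro mult_mono) auto
    then show "norm (g i 0) < H i 0"
      using C_gt[OF i] by (simp add: g_def H_def)
  qed (use assms in auto)
  moreover have "g 0 (norm z) = f z"
    using u by (simp add: g_def)
  ultimately show ?thesis
    by (simp add: H_def C_def)
qed

text \<open>A weight with an explicit primitive. Its first summand levels off once
  \<open>1 - t\<close> falls below \<open>\<eta>\<close> and will carry the monomials already
  passed; the second will carry the singular part. Exponents above 1 make both terms of the
  primitive nonnegative.\<close>

lemma solution_exp_bound:
  fixes a b c \<eta> :: real
  assumes "1 \<le> k" and sol: "is_solution k A f" and R: "R < 1" and ab: "1 < a" "1 < b"
    and c: "1 \<le> c" and \<eta>: "0 \<le> \<eta>"
    and A: "\<And>z. norm z \<le> R \<Longrightarrow> norm (A z) \<le>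
      (c * ((1 - norm z + \<eta>) powr (- a) + (1 - norm z) powr (- b))) ^ k"
    and z: "norm z \<le> R"
  shows "norm (f z) \<le> (1 + (\<Sum>i<k. norm ((deriv ^^ i) f 0))) *
    exp (c * ((1 - norm z + \<eta>) powr (1 - a) / (a - 1) + (1 - norm z) powr (1 - b) / (b - 1)))"
proof (rule solution_norm_le[OF \<open>1 \<le> k\<close> sol R _ _ _ _ _ A z])
  define w' where "w' t = c * (a * (1 - t + \<eta>) powr (- a - 1) + b * (1 - t) powr (- b - 1))" for t
  fix t assume t: "t \<in> {0..R}"
  have pos: "0 < 1 - t" "0 < 1 - t + \<eta>"
    using t R \<eta> by auto
  show "((\<lambda>t. c * ((1 - t + \<eta>) powr (- a) + (1 - t) powr (- b))) has_real_derivative w' t) (at t)"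
    unfolding w'_def using pos by (auto intro!: derivative_eq_intros simp: algebra_simps)
  show "0 \<le> w' t"
    unfolding w'_def using c ab by (intro mult_nonneg_nonneg add_nonneg_nonneg) auto
  have "1 powr (- b) \<le> (1 - t) powr (- b)"
    using pos t ab by (intro powr_mono2') auto
  then have "1 * 1 \<le> c * ((1 - t + \<eta>) powr (- a) + (1 - t) powr (- b))"
    using c by (intro mult_mono) (auto intro: add_increasing)
  then show "1 \<le> c * ((1 - t + \<eta>) powr (- a) + (1 - t) powr (- b))"
    by simp
  show "((\<lambda>t. c * ((1 - t + \<eta>) powr (1 - a) / (a - 1) + (1 - t) powr (1 - b) / (b - 1)))
      has_real_derivative c * ((1 - t + \<eta>) powr (- a) + (1 - t) powr (- b))) (at t)"
    using pos ab by (auto intro!: derivative_eq_intros simp: divide_simps) (simp add: algebra_simps)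
next
  show "0 \<le> c * ((1 - 0 + \<eta>) powr (1 - a) / (a - 1) + (1 - 0) powr (1 - b) / (b - 1))"
    using c ab by (intro mult_nonneg_nonneg add_nonneg_nonneg) auto
qed

text \<open>If \<open>log M\<close> grew by at most \<open>K\<close> over an interval of length \<open>h\<close>, then on one of its \<open>K\<close> equal parts it would
  grow by at most \<open>1\<close>, and Cauchy's estimate at a maximum point there bounds \<open>A = - f\<^sup>(\<^sup>k\<^sup>) / f\<close>.\<close>

lemma solution_growth_ge:
  assumes sol: "is_solution k A f" and r: "0 \<le> r" "0 < h" "r + h < 1" and "0 < K"
    and pos: "0 < max_modulus r f"
    and A: "\<And>z. r \<le> norm z \<Longrightarrow> norm z \<le> r + h \<Longrightarrow>
      fact k * exp 1 * (real K / h) ^ k < norm (A z)"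
  shows "exp (real K) * max_modulus r f < max_modulus (r + h) f"
proof (rule ccontr)
  assume not: "\<not> ?thesis"
  note hol = solution_holomorphic[OF sol]
  define d where "d = h / real K"
  have d: "0 < d" "real K * d = h"
    using r \<open>0 < K\<close> by (auto simp: d_def)
  define m where "m i = max_modulus (r + real i * d) f" for i
  have in_range: "r + real i * d \<le> r + h" if "i \<le> K" for i
    using that d by (metis add_left_mono less_imp_le mult_right_mono of_nat_le_iff)
  have m0: "m 0 = max_modulus r f" and mK: "m K = max_modulus (r + h) f"
    using d by (simp_all add: m_def)
  have "\<exists>i<K. m (Suc i) \<le> exp 1 * m i"
  proof (rule ccontr)
    assume no: "\<not> ?thesis"
    have "exp (real i) * m 0 \<le> m i" if "i \<le> K" for i
      using that
    proof (induction i)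
      case (Suc i)
      then have "exp 1 * (exp (real i) * m 0) \<le> exp 1 * m i"
        by (intro mult_left_mono) auto
      also have "\<dots> < m (Suc i)"
        using no Suc.prems by (simp add: not_le)
      finally show ?case
        by (simp add: exp_add mult_ac)
    qed simp
    \<comment> \<open>The induction yields only non-strict bounds; splitting off the last part gives
      the strict one that contradicts \<open>not\<close>.\<close>
    moreover obtain K' where K': "K = Suc K'"
      using \<open>0 < K\<close> by (cases K) auto
    ultimately have "exp 1 * (exp (real K') * m 0) \<le> exp 1 * m K'"
      by (intro mult_left_mono) auto
    also have "\<dots> < m K"
      using no K' by (simp add: not_le)
    finally show False
      using not by (simp add: m0 mK[unfolded K'] K' exp_add mult_ac)
  qed
  then obtain i where i: "i < K" "m (Suc i) \<le> exp 1 * m i"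
    by blast
  define \<rho> where "\<rho> = r + real i * d"
  have \<rho>: "r \<le> \<rho>" "\<rho> + d \<le> r + h" "m i = max_modulus \<rho> f" "m (Suc i) = max_modulus (\<rho> + d) f"
    using in_range[of "Suc i"] i d by (auto simp: \<rho>_def m_def algebra_simps)
  have cont: "continuous_on unit_disc f"
    using hol holomorphic_on_imp_continuous_on by blast
  have "sphere 0 \<rho> \<subseteq> unit_disc"
    using \<rho> r d by auto
  then obtain z where z: "norm z = \<rho>" "norm (f z) = max_modulus \<rho> f"
    using max_modulus_attained[of \<rho> f] cont continuous_on_subset \<rho> r by (metis order.trans)
  have ball: "norm w \<le> \<rho> + d" if "w \<in> cball z d" for w
    using that z norm_triangle_ineq2[of w z] by (auto simp: dist_norm norm_minus_commute)
  then have sub: "cball z d \<subseteq> unit_disc"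
    using \<rho> r by force
  \<comment> \<open>The disc of radius \<open>d\<close> about the maximum point \<open>z\<close>
    lies in \<open>\<bar>w\<bar> \<le> \<rho> + d\<close>, where \<open>\<bar>f\<bar>\<close> is at
    most \<open>m (Suc i) \<le> exp 1 * \<bar>f z\<bar>\<close>. This is the source of the factor
    \<open>fact k * exp 1\<close>.\<close>
  have "norm ((deriv ^^ k) f z) \<le> fact k * m (Suc i) / d ^ k"
  proof (rule Cauchy_inequality)
    show "f holomorphic_on ball z d"
      using hol sub ball_subset_cball holomorphic_on_subset by blast
    show "continuous_on (cball z d) f"
      using cont sub continuous_on_subset by blast
    show "norm (f x) \<le> m (Suc i)" if "norm (z - x) = d" for x
      using ball[of x] that \<rho> r norm_le_max_modulus_cball[OF hol, of "\<rho> + d" x]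
      by (auto simp: dist_norm)
  qed (use d in auto)
  also have "\<dots> \<le> fact k * (exp 1 * norm (f z)) / d ^ k"
    using i d \<rho> z by (intro divide_right_mono mult_left_mono) auto
  also have "\<dots> = fact k * exp 1 * (real K / h) ^ k * norm (f z)"
    by (simp add: d_def power_divide)
  finally have "norm ((deriv ^^ k) f z) \<le> fact k * exp 1 * (real K / h) ^ k * norm (f z)" .
  moreover have "(deriv ^^ k) f z = - (A z * f z)"
    using sol sub d by (simp add: is_solution_def eq_neg_iff_add_eq_0 subset_iff)
  ultimately have "norm (A z) * norm (f z) \<le> fact k * exp 1 * (real K / h) ^ k * norm (f z)"
    by (simp add: norm_mult)
  moreover have "0 < norm (f z)"
    using pos max_modulus_mono[OF hol, of r \<rho>] z \<rho> r d by simp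
  ultimately have "norm (A z) \<le> fact k * exp 1 * (real K / h) ^ k"
    by simp
  moreover have "norm z \<le> r + h" "r \<le> norm z"
    using z \<rho> d by auto
  ultimately show False
    using A[of z] by simp
qed

section \<open>The coefficient\<close>

text \<open>\<open>N_gap\<close> amounts to \<open>N j powr p2 \<le> N (Suc j) powr p1\<close>: once
  \<open>1 - r\<close> has shrunk to \<open>1 / N (Suc j)\<close>, each earlier monomial is
  dominated by \<open>(1 - r) powr - p1\<close>. \<open>N_double\<close> makes negative powers of
  \<open>N j\<close> summable.\<close>

locale gap_coefficient =
  fixes N :: "nat \<Rightarrow> nat" and p1 p2 :: real
  assumes p1_pos: "0 < p1" and p1_less_p2: "p1 < p2"
    and N_ge_2: "\<And>j. 2 \<le> N j"
    and N_double: "\<And>j. 2 * N j \<le> N (Suc j)"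
    and N_gap: "\<And>j. real (N j) \<le> real (N (Suc j)) powr (p1 / p2)"
begin

section \<open>Growth of the exponents and size of the monomials\<close>

lemma N_pos: "0 < N j"
  using N_ge_2[of j] by simp

lemma ln_N_pos: "0 < ln (real (N j))"
  using N_ge_2[of j] by simp

lemma N_mono: "i \<le> j \<Longrightarrow> N i \<le> N j"
  using lift_Suc_mono_le[of N] N_double by (metis add_leD1 mult_2)

lemma N_gap_less:
  assumes "i < j"
  shows "real (N i) \<le> real (N j) powr (p1 / p2)"
proof -
  have "real (N (Suc i)) powr (p1 / p2) \<le> real (N j) powr (p1 / p2)"
    using assms N_mono[of "Suc i" j] p1_pos p1_less_p2 by (intro powr_mono2) auto
  then show ?thesis
    using N_gap[of i] by linarith
qed

lemma two_power_le_N: "2 ^ j \<le> N j"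
  by (induction j) (use N_ge_2[of 0] N_double in \<open>auto intro: order.trans[OF _ N_double]\<close>)

lemma filterlim_N: "filterlim (\<lambda>j. real (N j)) at_top sequentially"
proof (rule filterlim_at_top_mono)
  show "filterlim (\<lambda>j. 2 ^ j :: real) at_top sequentially"
    by real_asymp
  show "\<forall>\<^sub>F j in sequentially. 2 ^ j \<le> real (N j)"
    using two_power_le_N by (metis (mono_tags, lifting) always_eventually of_nat_le_iff of_nat_numeral of_nat_power)
qed

lemma summable_N_powr:
  assumes "0 < \<delta>"
  shows "summable (\<lambda>j. real (N j) powr - \<delta>)"
proof (rule summable_comparison_test')
  show "summable (\<lambda>j. (2 powr - \<delta> :: real) ^ j)"
    using assms by (intro summable_geometric) (auto simp: powr_minus field_simps)
  fix j :: nat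
  have "(2 ^ j :: real) \<le> real (N j)"
    using two_power_le_N[of j] by (metis of_nat_le_iff of_nat_numeral of_nat_power)
  then have "real (N j) powr - \<delta> \<le> (2 ^ j) powr - \<delta>"
    using assms by (intro powr_mono2') auto
  also have "\<dots> = (2 powr - \<delta>) ^ j"
    by (simp add: powr_powr mult.commute flip: powr_realpow)
  finally show "norm (real (N j) powr - \<delta>) \<le> (2 powr - \<delta>) ^ j"
    by simp
qed

text \<open>Raising the exponent \<open>p2\<close> to \<open>p2 + \<delta>\<close> leaves a factor
  \<open>N j powr - \<delta>\<close> in each term; this constant is the total cost of these
  factors.\<close>

definition inverse_powr_sum where "inverse_powr_sum \<delta> = (\<Sum>j. real (N j) powr - \<delta>)"

lemma inverse_powr_sum_nonneg: "0 < \<delta> \<Longrightarrow> 0 \<le> inverse_powr_sum \<delta>"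
  unfolding inverse_powr_sum_def by (intro suminf_nonneg summable_N_powr) auto

lemma sum_N_powr_le: "0 < \<delta> \<Longrightarrow> finite I \<Longrightarrow> (\<Sum>i\<in>I. real (N i) powr - \<delta>) \<le> inverse_powr_sum \<delta>"
  unfolding inverse_powr_sum_def by (intro sum_le_suminf summable_N_powr) auto

text \<open>The modulus of the \<open>j\<close>-th monomial of the coefficient on the circle of
  radius \<open>t\<close>.\<close>

definition majorant_term where "majorant_term t j = real (N j) powr p2 * t ^ N j"

lemma majorant_term_nonneg: "0 \<le> t \<Longrightarrow> 0 \<le> majorant_term t j"
  by (simp add: majorant_term_def)

text \<open>Split \<open>N j powr p2\<close> as \<open>N j powr - (Q - p2) * N j powr Q\<close>: the
  first factor is summable over \<open>j\<close>, the second is absorbed by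
  \<open>t ^ N j\<close>.\<close>

lemma majorant_term_le:
  assumes "0 \<le> t" "t < 1" "p2 < Q" "0 \<le> \<eta>" "\<eta> \<le> 1 / real (N j)"
  shows "majorant_term t j \<le> real (N j) powr - (Q - p2) * (exp 1 * Q powr Q * (1 - t + \<eta>) powr - Q)"
proof -
  have "real (N j) powr Q * t ^ N j \<le> exp 1 * Q powr Q * (1 - t + \<eta>) powr - Q"
    using assms N_pos[of j] p1_pos p1_less_p2 by (intro powr_times_power_le) auto
  then have "real (N j) powr - (Q - p2) * (real (N j) powr Q * t ^ N j)
      \<le> real (N j) powr - (Q - p2) * (exp 1 * Q powr Q * (1 - t + \<eta>) powr - Q)"
    by (intro mult_left_mono) auto
  moreover have "real (N j) powr - (Q - p2) * (real (N j) powr Q * t ^ N j) = majorant_term t j"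
    by (simp add: majorant_term_def mult.assoc[symmetric] flip: powr_add)
  ultimately show ?thesis
    by simp
qed

lemma summable_majorant_term:
  assumes "0 \<le> t" "t < 1"
  shows "summable (majorant_term t)"
proof (rule summable_comparison_test')
  show "summable (\<lambda>j. real (N j) powr - 1 * (exp 1 * (p2 + 1) powr (p2 + 1) * (1 - t) powr - (p2 + 1)))"
    by (intro summable_mult2 summable_N_powr) auto
  fix j :: nat
  show "norm (majorant_term t j) \<le> real (N j) powr - 1 * (exp 1 * (p2 + 1) powr (p2 + 1) * (1 - t) powr - (p2 + 1))"
    using majorant_term_le[of t "p2 + 1" 0 j] majorant_term_nonneg[of t j] assms by simp
qed

definition majorant where "majorant t = suminf (majorant_term t)"

lemma majorant_nonneg: "0 \<le> t \<Longrightarrow> t < 1 \<Longrightarrow> 0 \<le> majorant t"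
  unfolding majorant_def by (intro suminf_nonneg summable_majorant_term majorant_term_nonneg) auto

lemma majorant_term_le_majorant:
  assumes "0 \<le> t" "t < 1"
  shows "majorant_term t j \<le> majorant t"
  unfolding majorant_def using sum_le_suminf[OF summable_majorant_term[OF assms], of "{j}"] majorant_term_nonneg assms by simp

lemma majorant_le:
  assumes "0 \<le> t" "t < 1" "p2 < Q"
  shows "majorant t \<le> inverse_powr_sum (Q - p2) * (exp 1 * Q powr Q) * (1 - t) powr - Q"
proof -
  have "majorant t \<le> (\<Sum>j. real (N j) powr - (Q - p2) * (exp 1 * Q powr Q * (1 - t) powr - Q))"
    unfolding majorant_def using majorant_term_le[of t Q 0] assms
    by (intro suminf_le summable_majorant_term summable_mult2 summable_N_powr) auto
  also have "\<dots> = inverse_powr_sum (Q - p2) * (exp 1 * Q powr Q * (1 - t) powr - Q)"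
    unfolding inverse_powr_sum_def using assms by (intro suminf_mult2[symmetric] summable_N_powr) auto
  finally show ?thesis
    by (simp add: mult_ac)
qed

text \<open>The shift \<open>1 / N j\<close> is admissible for all \<open>i \<le> j\<close> at once.
  Hence the monomials up to the \<open>j\<close>-th stay at most of order \<open>N j powr Q\<close>
  as \<open>t\<close> tends to 1, instead of following \<open>(1 - t) powr - Q\<close>.\<close>

lemma majorant_term_head_le:
  assumes "0 \<le> t" "t < 1" "p2 < Q"
  shows "(\<Sum>i<Suc j. majorant_term t i) \<le> inverse_powr_sum (Q - p2) * (exp 1 * Q powr Q) * (1 - t + 1 / real (N j)) powr - Q"
proof -
  have "(\<Sum>i<Suc j. majorant_term t i) \<le>
      (\<Sum>i<Suc j. real (N i) powr - (Q - p2) * (exp 1 * Q powr Q * (1 - t + 1 / real (N j)) powr - Q))"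
  proof (intro sum_mono majorant_term_le)
    fix i assume "i \<in> {..<Suc j}"
    then show "1 / real (N j) \<le> 1 / real (N i)"
      using N_mono[of i j] N_pos by (intro divide_left_mono) auto
  qed (use assms in auto)
  also have "\<dots> = (\<Sum>i<Suc j. real (N i) powr - (Q - p2)) * (exp 1 * Q powr Q * (1 - t + 1 / real (N j)) powr - Q)"
    by (rule sum_distrib_right[symmetric])
  also have "\<dots> \<le> inverse_powr_sum (Q - p2) * (exp 1 * Q powr Q * (1 - t + 1 / real (N j)) powr - Q)"
    using assms by (intro mult_right_mono sum_N_powr_le) auto
  finally show ?thesis
    by (simp add: mult_ac)
qed

text \<open>For \<open>i > j\<close> the hypothesis makes \<open>t ^ N i\<close> at most
  \<open>exp (- (c * N i powr \<eta>))\<close>. This outweighs \<open>N i powr (p2 + 1)\<close>, and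
  the spare \<open>N i powr - 1\<close> sums to a constant independent of \<open>j\<close> and
  \<open>t\<close>.\<close>

lemma majorant_term_tail_le:
  assumes "0 < c" "0 < \<eta>"
  obtains C where "0 \<le> C" "\<And>j t. 0 \<le> t \<Longrightarrow> t < 1 \<Longrightarrow>
    (\<And>i. j < i \<Longrightarrow> c * real (N i) powr \<eta> \<le> real (N i) * (1 - t)) \<Longrightarrow> (\<Sum>i. majorant_term t (i + Suc j)) \<le> C"
proof -
  define K where "K = ((p2 + 1) / \<eta>) powr ((p2 + 1) / \<eta>) / c powr ((p2 + 1) / \<eta>)"
  have K: "0 \<le> K"
    by (simp add: K_def)
  have "(\<Sum>i. majorant_term t (i + Suc j)) \<le> inverse_powr_sum 1 * K"
    if t: "0 \<le> t" "t < 1" and *: "\<And>i. j < i \<Longrightarrow> c * real (N i) powr \<eta> \<le> real (N i) * (1 - t)" for j t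
  proof -
    have le: "majorant_term t (i + Suc j) \<le> real (N (i + Suc j)) powr - 1 * K" for i
    proof -
      define n where "n = N (i + Suc j)"
      have n: "0 < n"
        using N_pos by (simp add: n_def)
      have "t ^ n \<le> exp (- (real n * (1 - t)))"
        using t by (intro power_le_exp_one_minus) auto
      also have "\<dots> \<le> exp (- (c * real n powr \<eta>))"
        using *[of "i + Suc j"] by (simp add: n_def)
      finally have "real n powr (p2 + 1) * t ^ n \<le> real n powr (p2 + 1) * exp (- (c * real n powr \<eta>))"
        by (intro mult_left_mono) auto
      also have "\<dots> \<le> K"
        unfolding K_def using assms n p1_pos p1_less_p2 by (intro powr_times_exp_le) auto
      finally have "real n powr - 1 * (real n powr (p2 + 1) * t ^ n) \<le> real n powr - 1 * K"
        by (intro mult_left_mono) auto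
      moreover have "real n powr - 1 * (real n powr (p2 + 1) * t ^ n) = majorant_term t (i + Suc j)"
        by (simp only: majorant_term_def n_def mult.assoc[symmetric] powr_add[symmetric]) simp
      ultimately show ?thesis
        by (simp add: n_def)
    qed
    have sN: "summable (\<lambda>i. real (N (i + Suc j)) powr - 1)"
      using summable_N_powr[of 1] by (intro summable_ignore_initial_segment) auto
    have "(\<Sum>i. majorant_term t (i + Suc j)) \<le> (\<Sum>i. real (N (i + Suc j)) powr - 1 * K)"
      using le t by (intro suminf_le summable_mult2 sN summable_ignore_initial_segment summable_majorant_term)
    also have "\<dots> = (\<Sum>i. real (N (i + Suc j)) powr - 1) * K"
      using sN by (intro suminf_mult2[symmetric])
    also have "\<dots> \<le> inverse_powr_sum 1 * K"
    proof (intro mult_right_mono K)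
      have "inverse_powr_sum 1 = (\<Sum>i. real (N (i + Suc j)) powr - 1) + (\<Sum>i<Suc j. real (N i) powr - 1)"
        unfolding inverse_powr_sum_def using summable_N_powr[of 1] by (intro suminf_split_initial_segment) auto
      moreover have "0 \<le> (\<Sum>i<Suc j. real (N i) powr - 1)"
        by (intro sum_nonneg) auto
      ultimately show "(\<Sum>i. real (N (i + Suc j)) powr - 1) \<le> inverse_powr_sum 1"
        by linarith
    qed
    finally show ?thesis .
  qed
  moreover have "0 \<le> inverse_powr_sum 1 * K"
    using K inverse_powr_sum_nonneg[of 1] by simp
  ultimately show thesis
    using that by blast
qed

lemma majorant_split:
  assumes "0 \<le> t" "t < 1"
  shows "majorant t = (\<Sum>i. majorant_term t (i + Suc j)) + (\<Sum>i<Suc j. majorant_term t i)"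
  unfolding majorant_def using summable_majorant_term[OF assms] by (rule suminf_split_initial_segment)

definition A :: "complex \<Rightarrow> complex" where
  "A z = (1 - z) powr of_real (- p1) + (\<Sum>j. of_real (real (N j) powr p2) * z ^ N j)"

lemma norm_summand: "norm (of_real (real (N j) powr p2) * z ^ N j :: complex) = majorant_term (norm z) j"
  by (simp add: majorant_term_def norm_mult norm_power)

lemma summable_norm_summand:
  assumes "norm (z :: complex) < 1"
  shows "summable (\<lambda>j. norm (of_real (real (N j) powr p2) * z ^ N j))"
  unfolding norm_summand using assms by (intro summable_majorant_term) auto

text \<open>The series converges locally uniformly by comparison with
  \<open>majorant_term t\<close>, and the principal power is analytic because \<open>1 - z\<close>
  avoids the nonpositive real axis.\<close>

lemma A_analytic: "A analytic_on unit_disc"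
proof -
  define u :: "nat \<Rightarrow> complex \<Rightarrow> complex" where "u j z = of_real (real (N j) powr p2) * z ^ N j" for j z
  obtain g where g: "\<forall>z\<in>unit_disc. (\<lambda>j. u j z) sums g z \<and> g field_differentiable (at z)"
  proof (rule series_differentiable_comparison_complex[of unit_disc u])
    show "u n field_differentiable at z" for n z
      unfolding u_def by (intro derivative_intros)
    fix z :: complex assume z: "z \<in> unit_disc"
    \<comment> \<open>The midpoint of \<open>\<bar>z\<bar>\<close> and 1: the ball of radius
      \<open>t - \<bar>z\<bar>\<close> about \<open>z\<close> stays inside the disc of radius
      \<open>t < 1\<close>.\<close>
    define t where "t = (1 + norm z) / 2"
    have t: "norm z < t" "0 \<le> t" "t < 1"
      using z by (auto simp: t_def)
    have "norm (u j w) \<le> norm (of_real (majorant_term t j) :: complex)" if "w \<in> ball z (t - norm z)" for j w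
    proof -
      have "norm w < t"
        using that norm_triangle_ineq2[of w z] by (auto simp: dist_norm norm_minus_commute)
      then have "majorant_term (norm w) j \<le> majorant_term t j"
        unfolding majorant_term_def by (intro mult_left_mono power_mono) auto
      then show ?thesis
        using majorant_term_nonneg[OF t(2), of j] unfolding u_def norm_summand by simp
    qed
    moreover have "range (\<lambda>j. of_real (majorant_term t j) :: complex) \<subseteq> \<real>\<^sub>\<ge>\<^sub>0"
      using majorant_term_nonneg[OF t(2)] by auto
    ultimately show "\<exists>d (h::nat \<Rightarrow> complex). 0 < d \<and> summable h \<and> range h \<subseteq> \<real>\<^sub>\<ge>\<^sub>0 \<and>
        (\<forall>\<^sub>F n in sequentially. \<forall>y\<in>ball z d \<inter> unit_disc. norm (u n y) \<le> norm (h n))"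
      using t summable_majorant_term[OF t(2,3)]
      by (intro exI[of _ "t - norm z"] exI[of _ "\<lambda>j. of_real (majorant_term t j) :: complex"]) (auto intro!: summable_of_real always_eventually)
  qed auto
  then have "g holomorphic_on unit_disc"
    unfolding holomorphic_on_def using field_differentiable_at_within by blast
  moreover have "1 - z \<notin> \<real>\<^sub>\<le>\<^sub>0" if "z \<in> unit_disc" for z :: complex
    using that complex_Re_le_cmod[of z] by (auto simp: complex_nonpos_Reals_iff)
  then have "(\<lambda>z. (1 - z) powr of_real (- p1)) holomorphic_on unit_disc"
    by (intro holomorphic_intros) auto
  ultimately have "(\<lambda>z. (1 - z) powr of_real (- p1) + g z) holomorphic_on unit_disc"
    by (intro holomorphic_on_add)
  moreover have "(1 - z) powr of_real (- p1) + g z = A z" if "z \<in> unit_disc" for z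
    using g that sums_unique unfolding A_def u_def by fastforce
  ultimately have "A holomorphic_on unit_disc"
    using holomorphic_transform by blast
  then show ?thesis
    by (simp add: analytic_on_open)
qed

section \<open>Pointwise bounds for the coefficient\<close>

lemma norm_singular_part_le:
  assumes "norm (z :: complex) < 1"
  shows "norm ((1 - z) powr of_real (- p1)) \<le> (1 - norm z) powr - p1"
proof -
  have "norm ((1 - z) powr of_real (- p1)) = norm (1 - z) powr - p1"
    by (subst norm_powr_real_powr') auto
  also have "\<dots> \<le> (1 - norm z) powr - p1"
    using assms p1_pos norm_triangle_ineq2[of 1 z] by (intro powr_mono2') auto
  finally show ?thesis .
qed

lemma norm_A_le:
  assumes "norm z < 1"
  shows "norm (A z) \<le> (1 - norm z) powr - p1 + majorant (norm z)"
proof -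
  have "norm (\<Sum>j. of_real (real (N j) powr p2) * z ^ N j) \<le> majorant (norm z)"
    using summable_norm[OF summable_norm_summand[OF assms]] unfolding norm_summand majorant_def .
  then show ?thesis
    unfolding A_def using norm_triangle_mono norm_singular_part_le[OF assms] by blast
qed

text \<open>On the positive radius all terms are nonnegative reals, so nothing cancels and the bound
  \<open>norm_A_le\<close> is attained.\<close>

lemma norm_A_of_real:
  assumes "0 \<le> r" "r < 1"
  shows "norm (A (of_real r)) = (1 - r) powr - p1 + majorant r"
proof -
  have "(\<Sum>j. of_real (real (N j) powr p2) * of_real r ^ N j :: complex) = of_real (majorant r)"
    using suminf_of_real[OF summable_majorant_term[OF assms], where 'a = complex] by (simp add: majorant_def majorant_term_def[abs_def])
  moreover have "(1 - of_real r :: complex) powr of_real (- p1) = of_real ((1 - r) powr - p1)"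
    using powr_of_real[of "1 - r" "- p1"] assms by simp
  ultimately have "A (of_real r) = of_real ((1 - r) powr - p1 + majorant r)"
    by (simp add: A_def)
  then show ?thesis
    using majorant_nonneg[OF assms] by (simp only: norm_of_real) simp
qed

lemma norm_A_le_powr:
  assumes "p2 < Q"
  obtains C where "1 \<le> C" "\<And>z. norm z < 1 \<Longrightarrow> norm (A z) \<le> C * (1 - norm z) powr - Q"
proof -
  define C where "C = 1 + inverse_powr_sum (Q - p2) * (exp 1 * Q powr Q)"
  have "norm (A z) \<le> C * (1 - norm z) powr - Q" if "norm z < 1" for z
  proof -
    have "(1 - norm z) powr - p1 \<le> (1 - norm z) powr - Q"
      using assms p1_less_p2 that by (intro powr_mono') auto
    then show ?thesis
      using norm_A_le[OF that] majorant_le[of "norm z" Q] assms that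
      by (simp add: C_def algebra_simps)
  qed
  moreover have "1 \<le> C"
    using inverse_powr_sum_nonneg[of "Q - p2"] assms by (simp add: C_def)
  ultimately show thesis
    using that by blast
qed

text \<open>Up to this radius every later exponent satisfies
  \<open>N i * (1 - \<bar>z\<bar>) \<ge> N i powr e\<close>, so the tail stays bounded; the earlier
  monomials obey the shifted bound, and the singular part remains.\<close>

lemma norm_A_le_between:
  assumes "p2 < Q" "0 < e" "e < 1"
  obtains C where "1 \<le> C" "\<And>j z. norm z \<le> 1 - 1 / real (N (Suc j)) powr (1 - e) \<Longrightarrow>
    norm (A z) \<le> C * ((1 - norm z + 1 / real (N j)) powr - Q + (1 - norm z) powr - p1)"
proof -
  obtain C where C: "0 \<le> C" "\<And>j t. 0 \<le> t \<Longrightarrow> t < 1 \<Longrightarrow>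
    (\<And>i. j < i \<Longrightarrow> 1 * real (N i) powr e \<le> real (N i) * (1 - t)) \<Longrightarrow> (\<Sum>i. majorant_term t (i + Suc j)) \<le> C"
    using majorant_term_tail_le[of 1 e] assms by auto
  define B where "B = inverse_powr_sum (Q - p2) * (exp 1 * Q powr Q)"
  have B: "0 \<le> B"
    using inverse_powr_sum_nonneg[of "Q - p2"] assms by (simp add: B_def)
  have "norm (A z) \<le> (1 + C + B) * ((1 - norm z + 1 / real (N j)) powr - Q + (1 - norm z) powr - p1)"
    if z': "norm z \<le> 1 - 1 / real (N (Suc j)) powr (1 - e)" for j z
  proof -
    have z: "norm z \<le> 1 - real (N (Suc j)) powr - (1 - e)"
      using z' by (simp only: powr_minus_divide)
    define t where "t = norm z"
    have "0 < real (N (Suc j)) powr - (1 - e)"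
      using N_pos[of "Suc j"] by simp
    then have "t < 1"
      using z unfolding t_def by linarith
    then have t: "0 \<le> t" "t < 1"
      by (simp_all add: t_def)
    have "(\<Sum>i. majorant_term t (i + Suc j)) \<le> C"
    proof (intro C(2) t)
      fix i assume "j < i"
      then have "real (N i) powr - (1 - e) \<le> real (N (Suc j)) powr - (1 - e)"
        using assms N_mono[of "Suc j" i] N_pos by (intro powr_mono2') auto
      then have "real (N i) * real (N i) powr - (1 - e) \<le> real (N i) * (1 - t)"
        using z by (intro mult_left_mono) (auto simp: t_def)
      then show "1 * real (N i) powr e \<le> real (N i) * (1 - t)"
        using N_pos[of i] powr_add[of "real (N i)" 1 "- (1 - e)"] by simp
    qed
    moreover have "(\<Sum>i<Suc j. majorant_term t i) \<le> B * (1 - t + 1 / real (N j)) powr - Q"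
      unfolding B_def using t assms by (intro majorant_term_head_le)
    \<comment> \<open>The bounded tail is absorbed into the bound for the singular part, which is at
      least 1.\<close>
    moreover have "1 \<le> (1 - t) powr - p1"
      using t p1_pos powr_mono2'[of "- p1" "1 - t" 1] by simp
    then have "C * 1 \<le> C * (1 - t) powr - p1"
      using C by (intro mult_left_mono) auto
    moreover have "norm (A z) \<le> (1 - t) powr - p1 + ((\<Sum>i. majorant_term t (i + Suc j)) + (\<Sum>i<Suc j. majorant_term t i))"
      using norm_A_le[of z] majorant_split[OF t, of j] t by (simp add: t_def)
    ultimately have "norm (A z) \<le> (1 + C) * (1 - t) powr - p1 + B * (1 - t + 1 / real (N j)) powr - Q"
      by (simp add: algebra_simps)
    also have "\<dots> \<le> (1 + C + B) * (1 - t) powr - p1 + (1 + C + B) * (1 - t + 1 / real (N j)) powr - Q"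
      using B C(1) by (intro add_mono[OF mult_right_mono mult_right_mono]) auto
    finally show ?thesis
      by (simp add: t_def distrib_left add.commute)
  qed
  moreover have "1 \<le> 1 + C + B"
    using B C by simp
  ultimately show thesis
    using that by blast
qed

text \<open>Here the \<open>j\<close>-th monomial is at least
  \<open>exp (- 2) * N j powr p2\<close>, while the singular part and all other monomials together
  are of smaller order. A whole annulus is treated because \<open>solution_growth_ge\<close> tests
  \<open>A\<close> at maximum points of \<open>f\<close>, whose position is unknown.\<close>

lemma norm_A_ge_annulus:
  "\<forall>\<^sub>F j in sequentially. \<forall>z. 1 - 1 / real (N j) \<le> norm z \<longrightarrow> norm z \<le> 1 - 1 / (2 * real (N j)) \<longrightarrow>
    exp (- 2) / 2 * real (N j) powr p2 \<le> norm (A z)"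
proof -
  \<comment> \<open>\<open>\<delta>\<close> buys a summable factor for the earlier monomials, and
    \<open>N_gap\<close> bounds \<open>N i powr (p2 + \<delta>)\<close> by
    \<open>N j powr q\<close>. For this \<open>\<delta>\<close> one has
    \<open>p2 * (p2 - q) = (p2 - p1)^2\<close>, so \<open>q < p2\<close>.\<close>
  define \<delta> where "\<delta> = p2 - p1"
  define q where "q = p1 / p2 * (p2 + \<delta>)"
  have p2: "0 < p2"
    using p1_pos p1_less_p2 by linarith
  have \<delta>: "0 < \<delta>"
    using p1_less_p2 by (simp add: \<delta>_def)
  have "p2 * (p2 - q) = (p2 - p1)\<^sup>2"
    using p2 by (simp add: q_def \<delta>_def power2_eq_square field_simps)
  then have "0 < p2 * (p2 - q)"
    using p1_less_p2 by simp
  then have q: "q < p2"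
    using p2 by (simp add: zero_less_mult_iff)
  \<comment> \<open>The parameters fit the annulus: \<open>1 - t \<ge> 1 / (2 * N j)\<close> and
    \<open>N j \<le> N i powr (p1 / p2)\<close> for \<open>i > j\<close> give the required lower
    bound on \<open>N i * (1 - t)\<close>.\<close>
  obtain C where C: "0 \<le> C" "\<And>j t. 0 \<le> t \<Longrightarrow> t < 1 \<Longrightarrow>
    (\<And>i. j < i \<Longrightarrow> 1 / 2 * real (N i) powr (1 - p1 / p2) \<le> real (N i) * (1 - t)) \<Longrightarrow>
    (\<Sum>i. majorant_term t (i + Suc j)) \<le> C"
    using majorant_term_tail_le[of "1 / 2" "1 - p1 / p2"] p2 p1_less_p2 by auto
  \<comment> \<open>\<open>E j\<close> bounds everything except the \<open>j\<close>-th monomial,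
    relative to \<open>N j powr p2\<close>; all its exponents are negative.\<close>
  define E where "E j = 2 powr p1 * real (N j) powr (p1 - p2) + inverse_powr_sum \<delta> * real (N j) powr (q - p2)
    + C * real (N j) powr - p2" for j
  have null: "(\<lambda>j. real (N j) powr x) \<longlonglongrightarrow> 0" if "x < 0" for x
    using that filterlim_N by (rule tendsto_neg_powr)
  then have "E \<longlonglongrightarrow> 2 powr p1 * 0 + inverse_powr_sum \<delta> * 0 + C * 0"
    unfolding E_def[abs_def] using p2 q p1_less_p2
    by (intro tendsto_add tendsto_mult tendsto_const null) auto
  then have "\<forall>\<^sub>F j in sequentially. E j < exp (- 2) / 2"
    by (intro order_tendstoD(2)[of E]) auto
  then show ?thesis
  proof eventually_elim
    case (elim j)
    show ?case
    proof (intro allI impI)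
      fix z :: complex
      assume z: "1 - 1 / real (N j) \<le> norm z" "norm z \<le> 1 - 1 / (2 * real (N j))"
      define t where "t = norm z"
      define n where "n = real (N j)"
      have n: "2 \<le> n"
        using N_ge_2[of j] by (simp add: n_def)
      have "0 < 1 / (2 * n)"
        using n by simp
      then have t: "0 \<le> t" "t < 1" "1 / (2 * n) \<le> 1 - t"
        using z(2) norm_ge_zero[of z] unfolding t_def n_def by linarith+
      let ?u = "\<lambda>j. of_real (real (N j) powr p2) * z ^ N j"
      have sum: "summable ?u"
        using summable_norm_cancel[OF summable_norm_summand] t by (simp add: t_def)
      have "A z = (1 - z) powr of_real (- p1) + ((\<Sum>i. ?u (i + Suc j)) + (\<Sum>i<j. ?u i) + ?u j)"
        unfolding A_def using suminf_split_initial_segment[OF sum, of "Suc j"] by simp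
      then have eq: "?u j = A z - (1 - z) powr of_real (- p1) - (\<Sum>i. ?u (i + Suc j)) - (\<Sum>i<j. ?u i)"
        by (simp only: algebra_simps)
      have "norm (?u j) \<le> norm (A z) + norm ((1 - z) powr of_real (- p1))
          + norm (\<Sum>i. ?u (i + Suc j)) + norm (\<Sum>i<j. ?u i)"
        using norm_triangle_ineq4[of "A z" "(1 - z) powr of_real (- p1)"]
          norm_triangle_ineq4[of "A z - (1 - z) powr of_real (- p1)" "\<Sum>i. ?u (i + Suc j)"]
          norm_triangle_ineq4[of "A z - (1 - z) powr of_real (- p1) - (\<Sum>i. ?u (i + Suc j))" "\<Sum>i<j. ?u i"]
        unfolding eq by linarith
      moreover have "norm (?u j) = majorant_term t j"
        unfolding norm_summand t_def ..
      moreover have "norm (\<Sum>i. ?u (i + Suc j)) \<le> C"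
      proof -
        have "norm (\<Sum>i. ?u (i + Suc j)) \<le> (\<Sum>i. majorant_term t (i + Suc j))"
          using summable_norm[OF summable_ignore_initial_segment, OF summable_norm_summand[of z]] t
          unfolding norm_summand t_def by blast
        also have "\<dots> \<le> C"
        proof (intro C(2) t)
          fix i assume "j < i"
          then have "n \<le> real (N i) powr (p1 / p2)"
            unfolding n_def by (rule N_gap_less)
          then have "real (N i) / (2 * real (N i) powr (p1 / p2)) \<le> real (N i) / (2 * n)"
            using n N_pos[of i] by (intro divide_left_mono mult_left_mono mult_pos_pos) auto
          also have "\<dots> = real (N i) * (1 / (2 * n))"
            by simp
          also have "\<dots> \<le> real (N i) * (1 - t)"
            using t by (intro mult_left_mono) auto
          finally show "1 / 2 * real (N i) powr (1 - p1 / p2) \<le> real (N i) * (1 - t)"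
            using N_pos[of i] by (simp add: powr_diff)
        qed
        finally show ?thesis .
      qed
      moreover have "norm (\<Sum>i<j. ?u i) \<le> inverse_powr_sum \<delta> * n powr q"
      proof -
        have "norm (\<Sum>i<j. ?u i) \<le> (\<Sum>i<j. majorant_term t i)"
          using norm_sum[of ?u] unfolding norm_summand t_def .
        also have "\<dots> \<le> (\<Sum>i<j. real (N i) powr - \<delta> * n powr q)"
        proof (rule sum_mono)
          fix i assume "i \<in> {..<j}"
          then have "real (N i) powr (p2 + \<delta>) \<le> (n powr (p1 / p2)) powr (p2 + \<delta>)"
            unfolding n_def using p2 \<delta> N_gap_less[of i j] by (intro powr_mono2) auto
          then have *: "real (N i) powr (p2 + \<delta>) \<le> n powr q"
            by (simp add: powr_powr q_def)
          have "majorant_term t i \<le> real (N i) powr p2 * 1"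
            unfolding majorant_term_def using t by (intro mult_left_mono power_le_one) auto
          also have "\<dots> = real (N i) powr - \<delta> * real (N i) powr (p2 + \<delta>)"
            by (simp flip: powr_add)
          also have "\<dots> \<le> real (N i) powr - \<delta> * n powr q"
            using * by (intro mult_left_mono) auto
          finally show "majorant_term t i \<le> real (N i) powr - \<delta> * n powr q" .
        qed
        also have "\<dots> = (\<Sum>i<j. real (N i) powr - \<delta>) * n powr q"
          by (rule sum_distrib_right[symmetric])
        also have "\<dots> \<le> inverse_powr_sum \<delta> * n powr q"
          using \<delta> by (intro mult_right_mono sum_N_powr_le) auto
        finally show ?thesis .
      qed
      moreover have "norm ((1 - z) powr of_real (- p1)) \<le> (2 * n) powr p1"
      proof -
        have "norm ((1 - z) powr of_real (- p1)) \<le> (1 - t) powr - p1"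
          using norm_singular_part_le[of z] t by (simp add: t_def)
        also have "\<dots> \<le> (1 / (2 * n)) powr - p1"
          using t n p1_pos by (intro powr_mono2') auto
        also have "\<dots> = (2 * n) powr p1"
          using n by (simp add: powr_minus_divide powr_divide)
        finally show ?thesis .
      qed
      moreover have "exp (- 2) * n powr p2 \<le> majorant_term t j"
      proof -
        have "exp (- 2) \<le> (1 - 1 / n) ^ N j"
          unfolding n_def using N_ge_2 by (rule one_minus_inverse_power_ge)
        also have "\<dots> \<le> t ^ N j"
          using z n by (intro power_mono) (auto simp: t_def n_def)
        finally show ?thesis
          by (simp add: majorant_term_def n_def mult.commute[of _ "real (N j) powr p2"] mult_left_mono)
      qed
      moreover have "(2 * n) powr p1 + inverse_powr_sum \<delta> * n powr q + C = E j * n powr p2"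
        using n by (simp add: E_def n_def[symmetric] powr_mult distrib_right mult.assoc flip: powr_add)
      moreover have "E j * n powr p2 \<le> exp (- 2) / 2 * n powr p2"
        using elim by (intro mult_right_mono) auto
      ultimately show "exp (- 2) / 2 * real (N j) powr p2 \<le> norm (A z)"
        unfolding n_def by linarith
    qed
  qed
qed

section \<open>Degree and lower degree of the coefficient\<close>

lemma p2_pos: "0 < p2"
  using p1_pos p1_less_p2 by linarith

lemma filterlim_ln_N: "filterlim (\<lambda>j. ln (real (N j))) at_top sequentially"
  by (rule filterlim_compose[OF ln_at_top filterlim_N])

lemma filterlim_ln_N_Suc: "filterlim (\<lambda>j. ln (real (N (Suc j)))) at_top sequentially"
  using filterlim_ln_N by (rule filterlim_compose) (rule filterlim_Suc)

lemma A_holomorphic: "A holomorphic_on unit_disc"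
  using A_analytic by (rule analytic_imp_holomorphic)

lemma max_modulus_A_ge:
  assumes "0 \<le> r" "r < 1"
  shows "(1 - r) powr - p1 + majorant r \<le> max_modulus r A"
  using norm_le_max_modulus_cball[OF A_holomorphic, of r "of_real r"] norm_A_of_real[of r] assms
  by simp

text \<open>The upper bound uses the exponent \<open>p2 + e / 2\<close>, the other half of
  \<open>e\<close> absorbing constants. For the lower bound, at radius \<open>1 - 1 / N j\<close>
  the single term \<open>majorant_term r j\<close> is already at least
  \<open>exp (- 2) * N j powr p2\<close>.\<close>

lemma growth_degree_A: "growth_degree A = ereal p2"
proof (rule antisym)
  show "growth_degree A \<le> ereal p2"
    unfolding growth_degree_def
  proof (rule Limsup_ereal_le)
    fix e :: real assume e: "0 < e"
    obtain C where C: "1 \<le> C" "\<And>z. norm z < 1 \<Longrightarrow> norm (A z) \<le> C * (1 - norm z) powr - (p2 + e / 2)"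
      using norm_A_le_powr[of "p2 + e / 2"] e by auto
    have "\<forall>\<^sub>F r::real in at_left 1. 0 < r \<and> r < 1 \<and> 0 < ln (1 / (1 - r)) \<and> ln C \<le> e / 2 * ln (1 / (1 - r))"
      using e by (intro eventually_ge_multiple_at_left_1) auto
    then show "\<forall>\<^sub>F r in at_left 1. log_plus (max_modulus r A) / ln (1 / (1 - r)) \<le> p2 + e"
    proof eventually_elim
      case (elim r)
      have "1 \<le> (1 - r) powr - (p2 + e / 2)"
        using elim e p2_pos powr_mono2'[of "- (p2 + e / 2)" "1 - r" 1] by simp
      with C have one: "1 * 1 \<le> C * (1 - r) powr - (p2 + e / 2)"
        by (intro mult_mono) auto
      have "log_plus (max_modulus r A) \<le> ln (C * (1 - r) powr - (p2 + e / 2))"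
      proof (rule log_plus_le)
        show "max_modulus r A \<le> C * (1 - r) powr - (p2 + e / 2)"
          using C elim by (intro max_modulus_le) auto
      qed (use one elim max_modulus_nonneg[OF A_holomorphic, of r] in auto)
      also have "\<dots> = ln C + (p2 + e / 2) * ln (1 / (1 - r))"
        using C elim by (simp add: ln_mult ln_powr ln_div algebra_simps)
      also have "\<dots> \<le> (p2 + e) * ln (1 / (1 - r))"
        using elim by (simp add: algebra_simps)
      finally show ?case
        using elim by (simp add: pos_divide_le_eq)
    qed
  qed
  show "ereal p2 \<le> growth_degree A"
    unfolding growth_degree_def
  proof (rule Limsup_ereal_ge[OF filterlim_one_minus_inverse[OF filterlim_N]])
    fix e :: real assume "0 < e"
    have "(\<lambda>j. (- 2 + p2 * ln (N j)) / (0 + 1 * ln (N j))) \<longlonglongrightarrow> p2 / 1"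
      by (intro affine_ratio_tendsto filterlim_ln_N) auto
    then have "\<forall>\<^sub>F j in sequentially. p2 - e < (- 2 + p2 * ln (N j)) / (0 + 1 * ln (N j))"
      using \<open>0 < e\<close> by (intro order_tendstoD(1)) auto
    then show "\<forall>\<^sub>F j in sequentially. p2 - e \<le> log_plus (max_modulus (1 - 1 / real (N j)) A) /
        ln (1 / (1 - (1 - 1 / real (N j))))"
    proof eventually_elim
      case (elim j)
      define r where "r = 1 - 1 / real (N j)"
      have r: "0 \<le> r" "r < 1"
        using N_pos[of j] by (auto simp: r_def)
      have "exp (- 2) * real (N j) powr p2 \<le> majorant_term r j"
        using one_minus_inverse_power_ge[OF N_ge_2[of j]]
        by (simp add: majorant_term_def r_def mult.commute[of _ "real (N j) powr p2"] mult_left_mono)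
      also have "\<dots> \<le> max_modulus r A"
        using majorant_term_le_majorant[OF r, of j] max_modulus_A_ge[OF r] powr_ge_zero[of "1 - r" "- p1"] by linarith
      finally have "ln (exp (- 2) * real (N j) powr p2) \<le> log_plus (max_modulus r A)"
        using N_pos[of j] by (intro log_plus_ge) auto
      then have "- 2 + p2 * ln (N j) \<le> log_plus (max_modulus r A)"
        using N_pos[of j] by (simp add: ln_mult ln_powr)
      then have "(- 2 + p2 * ln (N j)) / ln (N j) \<le> log_plus (max_modulus r A) / ln (N j)"
        using ln_N_pos[of j] by (intro divide_right_mono) auto
      then show ?case
        using elim by (simp add: r_def)
    qed
  qed
qed

lemma one_minus_powr_N:
  fixes r x :: real
  assumes "r = 1 - 1 / real (N j) powr x" "0 < x"
  shows "0 < r" "r < 1" "ln (1 / (1 - r)) = x * ln (N j)" "(1 - r) powr - q = real (N j) powr (x * q)"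
proof -
  have N: "1 < real (N j)"
    using N_ge_2[of j] by simp
  then have "1 < real (N j) powr x"
    using assms by simp
  then show "0 < r"
    using assms(1) N_pos[of j] by simp
  show "r < 1"
    using assms N_pos[of j] by simp
  show "ln (1 / (1 - r)) = x * ln (N j)"
    using assms N by (simp add: ln_powr)
  show "(1 - r) powr - q = real (N j) powr (x * q)"
    using assms N by (simp add: powr_minus_divide powr_divide powr_powr)
qed

lemma filterlim_one_minus_powr_N:
  assumes "0 < x"
  shows "filterlim (\<lambda>j. 1 - 1 / real (N (Suc j)) powr x) (at_left 1) sequentially"
proof (rule filterlim_one_minus_inverse)
  have "filterlim (\<lambda>j. real (N (Suc j))) at_top sequentially"
    using filterlim_N by (rule filterlim_compose) (rule filterlim_Suc)
  moreover have "filterlim (\<lambda>y::real. y powr x) at_top at_top"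
    using assms by real_asymp
  ultimately show "filterlim (\<lambda>j. real (N (Suc j)) powr x) at_top sequentially"
    using filterlim_compose by blast
qed

lemma shifted_powr_le_powr_N:
  assumes "0 < q" "r < 1"
  shows "(1 - r + 1 / real (N j)) powr - q \<le> real (N j) powr q"
proof -
  have "(1 - r + 1 / real (N j)) powr - q \<le> (1 / real (N j)) powr - q"
    using assms N_pos[of j] by (intro powr_mono2') auto
  also have "\<dots> = real (N j) powr q"
    using N_pos[of j] by (simp add: powr_minus_divide powr_divide)
  finally show ?thesis .
qed

text \<open>Just before the peak \<open>j + 1\<close>, where
  \<open>1 - r = N (Suc j) powr - (1 - x)\<close>, the earlier monomials have levelled off at order
  \<open>N j powr Q\<close>, which \<open>N_gap\<close> bounds by
  \<open>N (Suc j) powr (p1 * (1 + x))\<close>. The rate \<open>p1 * (1 + x) / (1 - x)\<close> tends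
  to \<open>p1\<close> as \<open>x\<close> tends to 0. Conversely the singular part alone gives
  \<open>p1\<close> at every radius.\<close>

lemma lower_growth_degree_A: "lower_growth_degree A = ereal p1"
proof (rule antisym)
  show "lower_growth_degree A \<le> ereal p1"
    unfolding lower_growth_degree_def
  proof (rule Liminf_ereal_le)
    fix e :: real assume "0 < e"
    moreover have "isCont (\<lambda>x. p1 * (1 + x) / (1 - x)) 0"
      by (intro continuous_intros) auto
    ultimately obtain x where x: "0 < x" "x < 1" "p1 * (1 + x) / (1 - x) < p1 + e"
      using isCont_exists_less[of "\<lambda>x. p1 * (1 + x) / (1 - x)" e] by auto
    define Q where "Q = p2 * (1 + x)"
    have Q: "p2 < Q" "p1 / p2 * Q = p1 * (1 + x)"
      using x p2_pos by (simp_all add: Q_def)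
    obtain C where C: "1 \<le> C" "\<And>j z. norm z \<le> 1 - 1 / real (N (Suc j)) powr (1 - x) \<Longrightarrow>
        norm (A z) \<le> C * ((1 - norm z + 1 / real (N j)) powr - Q + (1 - norm z) powr - p1)"
      using norm_A_le_between[of Q x] Q x by blast
    define r where "r j = 1 - 1 / real (N (Suc j)) powr (1 - x)" for j
    have "(\<lambda>j. (ln (2 * C) + p1 * (1 + x) * ln (N (Suc j))) / (0 + (1 - x) * ln (N (Suc j))))
        \<longlonglongrightarrow> p1 * (1 + x) / (1 - x)"
      using x by (intro affine_ratio_tendsto filterlim_ln_N_Suc) auto
    then have "\<forall>\<^sub>F j in sequentially.
        (ln (2 * C) + p1 * (1 + x) * ln (N (Suc j))) / (0 + (1 - x) * ln (N (Suc j))) < p1 + e"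
      using x by (intro order_tendstoD(2)) auto
    then have "\<forall>\<^sub>F j in sequentially. log_plus (max_modulus (r j) A) / ln (1 / (1 - r j)) \<le> p1 + e"
    proof eventually_elim
      case (elim j)
      have rdef: "r j = 1 - 1 / real (N (Suc j)) powr (1 - x)"
        by (simp add: r_def)
      note r = one_minus_powr_N[OF rdef]
      let ?n = "real (N (Suc j))"
      have n: "1 < ?n"
        using N_ge_2[of "Suc j"] by simp
      have "max_modulus (r j) A \<le> 2 * C * ?n powr (p1 * (1 + x))"
      proof (rule max_modulus_le)
        show "0 \<le> r j"
          using r x by simp
        fix z :: complex assume z: "norm z = r j"
        have "(1 - r j + 1 / real (N j)) powr - Q \<le> real (N j) powr Q"
          using r x Q p2_pos by (intro shifted_powr_le_powr_N) auto
        also have "\<dots> \<le> (?n powr (p1 / p2)) powr Q"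
          using N_gap[of j] Q p2_pos by (intro powr_mono2) auto
        also have "\<dots> = ?n powr (p1 * (1 + x))"
          by (simp only: powr_powr Q)
        finally have 1: "(1 - r j + 1 / real (N j)) powr - Q \<le> ?n powr (p1 * (1 + x))" .
        have "(1 - x) * p1 \<le> p1 * (1 + x)"
          using x p1_pos by (simp add: algebra_simps)
        then have 2: "(1 - r j) powr - p1 \<le> ?n powr (p1 * (1 + x))"
          using r(4)[of p1] x n by (simp add: powr_mono)
        have "norm (A z) \<le> C * ((1 - r j + 1 / real (N j)) powr - Q + (1 - r j) powr - p1)"
          using C(2)[of z j] z by (simp add: rdef)
        also have "\<dots> \<le> C * (?n powr (p1 * (1 + x)) + ?n powr (p1 * (1 + x)))"
          using 1 2 C by (intro mult_left_mono add_mono) auto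
        finally show "norm (A z) \<le> 2 * C * ?n powr (p1 * (1 + x))"
          by simp
      qed
      moreover have "1 * 1 \<le> 2 * C * ?n powr (p1 * (1 + x))"
        using C n p1_pos x by (intro mult_mono ge_one_powr_ge_zero) auto
      ultimately have "log_plus (max_modulus (r j) A) \<le> ln (2 * C * ?n powr (p1 * (1 + x)))"
        using r x max_modulus_nonneg[OF A_holomorphic, of "r j"] by (intro log_plus_le) auto
      also have "\<dots> = ln (2 * C) + p1 * (1 + x) * ln ?n"
        using C n by (simp add: ln_mult ln_powr)
      finally have "log_plus (max_modulus (r j) A) / ((1 - x) * ln ?n)
          \<le> (ln (2 * C) + p1 * (1 + x) * ln ?n) / ((1 - x) * ln ?n)"
        using x ln_N_pos[of "Suc j"] by (intro divide_right_mono) auto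
      then show ?case
        using elim r(3) x by simp
    qed
    moreover have "filterlim r (at_left 1) sequentially"
      unfolding r_def using x by (intro filterlim_one_minus_powr_N) auto
    ultimately show "\<exists>r. filterlim r (at_left 1) sequentially \<and>
        (\<forall>\<^sub>F j in sequentially. log_plus (max_modulus (r j) A) / ln (1 / (1 - r j)) \<le> p1 + e)"
      by blast
  qed
  show "ereal p1 \<le> lower_growth_degree A"
    unfolding lower_growth_degree_def
  proof (rule Liminf_ereal_ge)
    fix e :: real assume e: "0 < e"
    have "\<forall>\<^sub>F r::real in at_left 1. 0 < r \<and> r < 1 \<and> 0 < ln (1 / (1 - r)) \<and> 0 \<le> e * ln (1 / (1 - r))"
      using e by (rule eventually_ge_multiple_at_left_1)
    then show "\<forall>\<^sub>F r in at_left 1. p1 - e \<le> log_plus (max_modulus r A) / ln (1 / (1 - r))"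
    proof eventually_elim
      case (elim r)
      have "ln ((1 - r) powr - p1) \<le> log_plus (max_modulus r A)"
        using elim max_modulus_A_ge[of r] majorant_nonneg[of r] by (intro log_plus_ge) auto
      then have "p1 * ln (1 / (1 - r)) \<le> log_plus (max_modulus r A)"
        using elim by (simp add: ln_powr ln_div)
      then have "p1 \<le> log_plus (max_modulus r A) / ln (1 / (1 - r))"
        using elim by (simp add: pos_le_divide_eq)
      then show ?case
        using e by linarith
    qed
  qed
qed

section \<open>Orders of the solutions\<close>

text \<open>The weight has order \<open>(1 - t) powr - a\<close> with \<open>a\<close> slightly
  above \<open>p2 / k\<close>, so its primitive has order \<open>(1 - t) powr (1 - a)\<close>, and
  \<open>a - 1\<close> is \<open>p2 / k - 1 + e / 2\<close>.\<close>

lemma solution_order_le: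
  assumes k: "1 \<le> k" "real k < p2" and sol: "is_solution k A f"
  shows "growth_order f \<le> ereal (p2 / real k - 1)"
  unfolding growth_order_def
proof (rule Limsup_ereal_le)
  fix e :: real assume e: "0 < e"
  define a where "a = p2 / real k + e / 2"
  have a: "1 < a" "a * real k = p2 + real k * e / 2"
    using k e by (auto simp: a_def field_simps add_strict_increasing2)
  obtain C where C: "1 \<le> C" "\<And>z. norm z < 1 \<Longrightarrow> norm (A z) \<le> C * (1 - norm z) powr - (a * real k)"
    using norm_A_le_powr[of "a * real k"] k e a by auto
  define D where "D = 1 + (\<Sum>i<k. norm ((deriv ^^ i) f 0))"
  have D: "1 \<le> D"
    by (simp add: D_def sum_nonneg)
  \<comment> \<open>All constants are gathered in one factor; the summand 1 keeps
    \<open>B * ?P \<ge> 1\<close>, as \<open>log_plus_le\<close> demands.\<close>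
  define B where "B = 1 + ln D + C * (2 / (a - 1))"
  have B: "1 \<le> B"
    using D C a by (simp add: B_def)
  have "\<forall>\<^sub>F r::real in at_left 1. 0 < r \<and> r < 1 \<and> 0 < ln (1 / (1 - r)) \<and> ln B \<le> e / 2 * ln (1 / (1 - r))"
    using e by (intro eventually_ge_multiple_at_left_1) auto
  then show "\<forall>\<^sub>F r in at_left 1. log_plus (log_plus (max_modulus r f)) / ln (1 / (1 - r)) \<le> p2 / real k - 1 + e"
  proof eventually_elim
    case (elim r)
    let ?P = "(1 - r) powr (1 - a)"
    have P: "1 \<le> ?P"
      using elim a powr_mono2'[of "1 - a" "1 - r" 1] by simp
    have "max_modulus r f \<le> exp (B * ?P)"
    proof (rule max_modulus_le)
      fix z :: complex assume z: "norm z = r"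
      have "norm (f z) \<le> D * exp (C * ((1 - norm z + 0) powr (1 - a) / (a - 1) + (1 - norm z) powr (1 - a) / (a - 1)))"
        unfolding D_def
      \<comment> \<open>Only one scale matters here, so the two-term bound is used with
        \<open>\<eta> = 0\<close> and both exponents equal to \<open>a\<close>.\<close>
      proof (rule solution_exp_bound[OF k(1) sol _ a(1) a(1) C(1), of r])
        fix w :: complex assume w: "norm w \<le> r"
        let ?x = "(1 - norm w) powr - a"
        have "norm (A w) \<le> C * (1 - norm w) powr - (a * real k)"
          using w elim by (intro C(2)) auto
        also have "(1 - norm w) powr - (a * real k) = ?x ^ k"
          using w elim k by (simp add: powr_powr flip: powr_realpow)
        also have "C * ?x ^ k \<le> C * (?x ^ k + ?x ^ k)"
          using C by (intro mult_left_mono) auto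
        also have "\<dots> \<le> (C * (?x + ?x)) ^ k"
          using k C by (intro mult_power_sum_le) auto
        finally show "norm (A w) \<le> (C * ((1 - norm w + 0) powr - a + (1 - norm w) powr - a)) ^ k"
          by simp
      qed (use z elim in auto)
      also have "\<dots> = exp (ln D + C * (2 / (a - 1)) * ?P)"
        using z D by (simp add: exp_add)
      also have "\<dots> \<le> exp (B * ?P)"
      proof -
        have "ln D * 1 \<le> (1 + ln D) * ?P"
          using D P by (intro mult_mono) auto
        then show ?thesis
          by (simp add: B_def algebra_simps)
      qed
      finally show "norm (f z) \<le> exp (B * ?P)" .
    qed (use elim in auto)
    moreover have BP: "1 * 1 \<le> B * ?P"
      using B P by (intro mult_mono) auto
    moreover have "0 \<le> max_modulus r f"
      using elim by (intro max_modulus_nonneg solution_holomorphic[OF sol]) auto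
    ultimately have "log_plus (max_modulus r f) \<le> B * ?P"
      using log_plus_le[of "max_modulus r f" "exp (B * ?P)"] by simp
    then have "log_plus (log_plus (max_modulus r f)) \<le> ln (B * ?P)"
      using BP by (intro log_plus_le log_plus_nonneg) auto
    also have "\<dots> = ln B + (a - 1) * ln (1 / (1 - r))"
      using B elim by (simp add: ln_mult ln_powr ln_div algebra_simps)
    also have "\<dots> \<le> (p2 / real k - 1 + e) * ln (1 / (1 - r))"
      using elim by (simp add: a_def algebra_simps)
    finally show ?case
      using elim by (simp add: pos_divide_le_eq)
  qed
qed

text \<open>Just before the peak \<open>j + 1\<close> the monomials up to \<open>j\<close>
  contribute to the primitive at most about \<open>N j powr (p2 / k - 1)\<close>, which is about
  \<open>N (Suc j) powr (\<kappa> * (p2 / k - 1))\<close>. The singular part contributes at most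
  about \<open>N (Suc j) powr (p1 / k - 1)\<close>, by hypothesis no more.\<close>

lemma solution_lower_order_le:
  assumes k: "1 \<le> k" "real k \<le> p1" and sol: "is_solution k A f"
    and ratio: "(\<lambda>j. ln (N j) / ln (N (Suc j))) \<longlonglongrightarrow> \<kappa>"
    and \<kappa>: "0 \<le> \<kappa>" "p1 / real k - 1 \<le> \<kappa> * (p2 / real k - 1)"
  shows "lower_growth_order f \<le> ereal (\<kappa> * (p2 / real k - 1))"
  unfolding lower_growth_order_def
proof (rule Liminf_ereal_le)
  fix e :: real assume "0 < e"
  define \<gamma> where "\<gamma> = p2 / real k - 1"
  have \<gamma>: "0 < \<gamma>"
    using k p1_less_p2 by (simp add: \<gamma>_def)
  \<comment> \<open>A common exponent for both contributions: the product suffices for the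
    monomials, the extra \<open>x\<close> makes room for the singular part, and
    \<open>\<mu> 0 = \<kappa> * \<gamma>\<close>.\<close>
  define \<mu> where "\<mu> x = (\<kappa> + x) * (\<gamma> + x) + x" for x
  have "isCont (\<lambda>x. \<mu> x / (1 - x)) 0"
    unfolding \<mu>_def by (intro continuous_intros) auto
  then obtain x where x: "0 < x" "x < 1" "\<mu> x / (1 - x) < \<kappa> * \<gamma> + e"
    using isCont_exists_less[of "\<lambda>x. \<mu> x / (1 - x)" e] \<open>0 < e\<close> by (auto simp: \<mu>_def)
  define a where "a = p2 / real k + x"
  \<comment> \<open>The excess \<open>x\<close> gives \<open>b > 1\<close> even for
    \<open>p1 = k\<close>, where the primitive would otherwise be logarithmic.\<close>
  define b where "b = p1 / real k + x"
  have "1 \<le> p1 / real k"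
    using k by simp
  moreover have "p1 / real k < p2 / real k"
    using k p1_less_p2 by (simp add: divide_strict_right_mono)
  ultimately have ab: "1 < a" "1 < b"
    using x by (simp_all add: a_def b_def)
  have Q: "p2 < a * real k" "p1 \<le> b * real k"
    using k x by (simp_all add: a_def b_def field_simps)
  obtain C where C: "1 \<le> C" "\<And>j z. norm z \<le> 1 - 1 / real (N (Suc j)) powr (1 - x) \<Longrightarrow>
      norm (A z) \<le> C * ((1 - norm z + 1 / real (N j)) powr - (a * real k) + (1 - norm z) powr - p1)"
    using norm_A_le_between[OF Q(1) x(1,2)] by blast
  define D where "D = 1 + (\<Sum>i<k. norm ((deriv ^^ i) f 0))"
  have D: "1 \<le> D"
    by (simp add: D_def sum_nonneg)
  define B where "B = 1 + ln D + C * (1 / (a - 1) + 1 / (b - 1))"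
  have B: "1 \<le> B"
    using D C ab by (simp add: B_def)
  define r where "r j = 1 - 1 / real (N (Suc j)) powr (1 - x)" for j
  have "(\<lambda>j. (ln B + \<mu> x * ln (N (Suc j))) / (0 + (1 - x) * ln (N (Suc j)))) \<longlonglongrightarrow> \<mu> x / (1 - x)"
    using x by (intro affine_ratio_tendsto filterlim_ln_N_Suc) auto
  then have "\<forall>\<^sub>F j in sequentially.
      (ln B + \<mu> x * ln (N (Suc j))) / (0 + (1 - x) * ln (N (Suc j))) < \<kappa> * \<gamma> + e"
    using x by (intro order_tendstoD(2)) auto
  moreover have "\<forall>\<^sub>F j in sequentially. ln (N j) / ln (N (Suc j)) < \<kappa> + x"
    using ratio x by (intro order_tendstoD(2)) auto
  ultimately have "\<forall>\<^sub>F j in sequentially.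
      log_plus (log_plus (max_modulus (r j) f)) / ln (1 / (1 - r j)) \<le> \<kappa> * \<gamma> + e"
  proof eventually_elim
    case (elim j)
    have rdef: "r j = 1 - 1 / real (N (Suc j)) powr (1 - x)"
      by (simp add: r_def)
    note r = one_minus_powr_N[OF rdef]
    have r01: "0 < r j" "r j < 1"
      using r x by auto
    let ?n = "real (N (Suc j))"
    have n: "1 < ?n"
      using N_ge_2[of "Suc j"] by simp
    define P where "P = ?n powr \<mu> x"
    have "0 \<le> \<mu> x"
      using x \<gamma> \<kappa> by (simp add: \<mu>_def)
    then have P: "1 \<le> P"
      unfolding P_def using n by (intro ge_one_powr_ge_zero) auto
    have Pa: "(1 - r j + 1 / real (N j)) powr (1 - a) \<le> P"
    proof -
      have "(1 - r j + 1 / real (N j)) powr - (a - 1) \<le> real (N j) powr (a - 1)"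
        using r01 ab by (intro shifted_powr_le_powr_N) auto
      also have "\<dots> = exp ((\<gamma> + x) * ln (N j))"
        using N_pos[of j] by (simp add: powr_def a_def \<gamma>_def algebra_simps)
      also have "\<dots> \<le> exp (\<mu> x * ln ?n)"
      proof -
        have "ln (N j) \<le> (\<kappa> + x) * ln ?n"
          using elim(2) ln_N_pos[of "Suc j"] by (simp add: pos_divide_less_eq)
        then have "(\<gamma> + x) * ln (N j) \<le> (\<gamma> + x) * ((\<kappa> + x) * ln ?n)"
          using \<gamma> x by (intro mult_left_mono) auto
        also have "\<dots> \<le> \<mu> x * ln ?n"
          using x ln_N_pos[of "Suc j"] by (simp add: \<mu>_def algebra_simps)
        finally show ?thesis
          by simp
      qed
      also have "\<dots> = P"
        using N_pos[of "Suc j"] by (simp add: P_def powr_def)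
      finally show ?thesis
        by simp
    qed
    have Pb: "(1 - r j) powr (1 - b) \<le> P"
    proof -
      have "(1 - r j) powr - (b - 1) = ?n powr ((1 - x) * (b - 1))"
        using x by (intro r(4)) auto
      also have "\<dots> \<le> P"
        unfolding P_def
      proof (rule powr_mono)
        have "(1 - x) * (b - 1) \<le> 1 * (b - 1)"
          using x ab by (intro mult_right_mono) auto
        also have "\<dots> \<le> \<kappa> * \<gamma> + x"
          using \<kappa> by (simp add: b_def \<gamma>_def)
        also have "\<dots> \<le> \<mu> x"
          using x \<kappa> \<gamma> by (simp add: \<mu>_def algebra_simps)
        finally show "(1 - x) * (b - 1) \<le> \<mu> x" .
      qed (use n in auto)
      finally show ?thesis
        by simp
    qed
    have "max_modulus (r j) f \<le> exp (B * P)"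
    proof (rule max_modulus_le)
      fix z :: complex assume z: "norm z = r j"
      have "norm (f z) \<le> D * exp (C * ((1 - norm z + 1 / real (N j)) powr (1 - a) / (a - 1)
          + (1 - norm z) powr (1 - b) / (b - 1)))"
        unfolding D_def
      proof (rule solution_exp_bound[OF k(1) sol r01(2) ab C(1)])
        fix w :: complex assume w: "norm w \<le> r j"
        have w1: "0 < 1 - norm w" "0 < 1 - norm w + 1 / real (N j)"
          using w r01 N_pos[of j] by (auto intro: add_pos_pos)
        let ?x = "(1 - norm w + 1 / real (N j)) powr - a" and ?y = "(1 - norm w) powr - b"
        have "norm (A w) \<le> C * ((1 - norm w + 1 / real (N j)) powr - (a * real k) + (1 - norm w) powr - p1)"
          using w by (intro C(2)) (simp add: rdef)
        also have "\<dots> \<le> C * (?x ^ k + ?y ^ k)"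
        proof (intro mult_left_mono add_mono)
          show "(1 - norm w + 1 / real (N j)) powr - (a * real k) \<le> ?x ^ k"
            using w1 by (simp add: powr_powr flip: powr_realpow)
          have "(1 - norm w) powr - p1 \<le> (1 - norm w) powr - (b * real k)"
            using Q w1 by (intro powr_mono') auto
          then show "(1 - norm w) powr - p1 \<le> ?y ^ k"
            using w1 by (simp add: powr_powr flip: powr_realpow)
        qed (use C in auto)
        also have "\<dots> \<le> (C * (?x + ?y)) ^ k"
          using k C by (intro mult_power_sum_le) auto
        finally show "norm (A w) \<le> (C * (?x + ?y)) ^ k" .
      qed (use z in auto)
      also have "\<dots> \<le> D * exp (C * (P / (a - 1) + P / (b - 1)))"
        using Pa Pb z ab C D by (intro mult_left_mono add_mono divide_right_mono exp_le_cancel_iff[THEN iffD2]) auto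
      also have "\<dots> = exp (ln D + C * (1 / (a - 1) + 1 / (b - 1)) * P)"
        using D by (simp add: exp_add algebra_simps)
      also have "\<dots> \<le> exp (B * P)"
      proof -
        have "ln D * 1 \<le> (1 + ln D) * P"
          using D P by (intro mult_mono) auto
        then show ?thesis
          by (simp add: B_def algebra_simps)
      qed
      finally show "norm (f z) \<le> exp (B * P)" .
    qed (use r01 in auto)
    moreover have BP: "1 * 1 \<le> B * P"
      using B P by (intro mult_mono) auto
    moreover have "0 \<le> max_modulus (r j) f"
      using r01 by (intro max_modulus_nonneg solution_holomorphic[OF sol]) auto
    ultimately have "log_plus (max_modulus (r j) f) \<le> B * P"
      using log_plus_le[of "max_modulus (r j) f" "exp (B * P)"] by simp
    then have "log_plus (log_plus (max_modulus (r j) f)) \<le> ln (B * P)"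
      using BP by (intro log_plus_le log_plus_nonneg) auto
    also have "\<dots> = ln B + \<mu> x * ln ?n"
      using B n by (simp add: P_def ln_mult ln_powr)
    finally have "log_plus (log_plus (max_modulus (r j) f)) / ((1 - x) * ln ?n)
        \<le> (ln B + \<mu> x * ln ?n) / ((1 - x) * ln ?n)"
      using x ln_N_pos[of "Suc j"] by (intro divide_right_mono) auto
    then show ?case
      using elim(1) r(3) x by simp
  qed
  moreover have "filterlim r (at_left 1) sequentially"
    unfolding r_def using x by (intro filterlim_one_minus_powr_N) auto
  ultimately show "\<exists>r. filterlim r (at_left 1) sequentially \<and> (\<forall>\<^sub>F j in sequentially.
      log_plus (log_plus (max_modulus (r j) f)) / ln (1 / (1 - r j)) \<le> \<kappa> * (p2 / real k - 1) + e)"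
    unfolding \<gamma>_def by blast
qed

text \<open>\<open>solution_growth_ge\<close> is applied on the annulus of
  \<open>norm_A_ge_annulus\<close> with \<open>h = 1 / (2 * N j)\<close> and \<open>K\<close> of
  order \<open>N j powr s\<close>. Then \<open>(K / h) ^ k\<close> has order
  \<open>N j powr ((1 + s) * k)\<close>, which is eventually far below
  \<open>N j powr p2\<close>.\<close>

lemma solution_growth_at_peaks:
  assumes sol: "is_solution k A f" "nontrivial f" and s: "0 < s" "(1 + s) * real k < p2"
  shows "\<forall>\<^sub>F j in sequentially. exp (real (N j) powr s) \<le> max_modulus (1 - 1 / (2 * real (N j))) f"
proof -
  note hol = solution_holomorphic[OF sol(1)]
  \<comment> \<open>\<open>f\<close> may vanish at the origin, so positivity of
    \<open>M(r, f)\<close> comes from a point where \<open>f\<close> is nonzero, once the circles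
    enclose it.\<close>
  obtain z0 where z0: "norm z0 < 1" "f z0 \<noteq> 0"
    using sol(2) by (auto simp: nontrivial_def)
  define m where "m = norm (f z0)"
  have m: "0 < m"
    using z0 by (simp add: m_def)
  \<comment> \<open>The power of 6 comes from \<open>K / h \<le> 6 * n powr (1 + s)\<close>; the
    factor \<open>2 * exp 2\<close> cancels \<open>exp (- 2) / 2\<close> in the lower bound for
    \<open>A\<close>.\<close>
  define c where "c = fact k * exp 1 * 6 ^ k * (2 * exp 2 :: real)"
  have powr_top: "filterlim (\<lambda>j. real (N j) powr x) at_top sequentially" if "0 < x" for x
  proof -
    have "filterlim (\<lambda>y::real. y powr x) at_top at_top"
      using that by real_asymp
    then show ?thesis
      using filterlim_N by (rule filterlim_compose)
  qed
  have "\<forall>\<^sub>F j in sequentially. max 1 (- ln m) \<le> real (N j) powr s"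
    using powr_top[OF s(1)] by (simp only: filterlim_at_top)
  moreover have "\<forall>\<^sub>F j in sequentially. c < real (N j) powr (p2 - (1 + s) * real k)"
    using powr_top[of "p2 - (1 + s) * real k"] s by (simp only: filterlim_at_top_dense)
  moreover have "filterlim (\<lambda>j. 1 - 1 / real (N j)) (at_left 1) sequentially"
    by (intro filterlim_one_minus_inverse filterlim_N)
  then have "(\<lambda>j. 1 - 1 / real (N j)) \<longlonglongrightarrow> 1"
    by (simp add: filterlim_at)
  then have "\<forall>\<^sub>F j in sequentially. norm z0 < 1 - 1 / real (N j)"
    using z0 by (intro order_tendstoD(1)) auto
  ultimately show ?thesis
    using norm_A_ge_annulus
  proof eventually_elim
    case (elim j)
    define n where "n = real (N j)"
    have n: "2 \<le> n"
      using N_ge_2[of j] by (simp add: n_def)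
    \<comment> \<open>Of the exponent \<open>2 * n powr s\<close>, one half makes up for a possibly
      negative \<open>ln m\<close>. Since \<open>n powr s \<ge> 1\<close>, rounding up keeps
      \<open>K \<le> 3 * n powr s\<close>.\<close>
    define K where "K = nat \<lceil>2 * n powr s\<rceil>"
    have s1: "1 \<le> n powr s" "- ln m \<le> n powr s"
      using elim(1) by (auto simp: n_def)
    have K: "2 * n powr s \<le> real K" "real K \<le> 3 * n powr s" "0 < K"
      using s1 unfolding K_def by linarith+
    define r where "r = 1 - 1 / n"
    define h where "h = 1 / (2 * n)"
    have rh: "r + h = 1 - 1 / (2 * n)"
      using n by (simp add: r_def h_def field_simps)
    have r: "0 \<le> r" "0 < h" "r + h < 1"
      unfolding rh using n by (simp_all add: r_def h_def)
    have mr: "m \<le> max_modulus r f"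
      unfolding m_def using elim(3) r N_pos[of j] by (intro norm_le_max_modulus_cball[OF hol]) (auto simp: r_def n_def)
    have "exp (real K) * max_modulus r f < max_modulus (r + h) f"
    proof (rule solution_growth_ge[OF sol(1) r K(3)])
      show "0 < max_modulus r f"
        using m mr by linarith
      fix z :: complex assume z: "r \<le> norm z" "norm z \<le> r + h"
      have "real K / h \<le> 3 * n powr s / h"
        using K r by (intro divide_right_mono) auto
      also have "\<dots> = 6 * n powr (1 + s)"
        using n by (simp add: h_def powr_add)
      finally have "(real K / h) ^ k \<le> (6 * n powr (1 + s)) ^ k"
        using r by (intro power_mono) auto
      also have "\<dots> = 6 ^ k * n powr ((1 + s) * real k)"
        using n by (simp add: power_mult_distrib powr_powr flip: powr_realpow)
      finally have "fact k * exp 1 * (real K / h) ^ k \<le> fact k * exp 1 * (6 ^ k * n powr ((1 + s) * real k))"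
        by (intro mult_left_mono) auto
      also have "\<dots> = exp (- 2) / 2 * (c * n powr ((1 + s) * real k))"
        by (simp add: c_def exp_minus)
      also have "\<dots> < exp (- 2) / 2 * (n powr (p2 - (1 + s) * real k) * n powr ((1 + s) * real k))"
        using elim(2) n by (intro mult_strict_left_mono mult_strict_right_mono) (auto simp: n_def)
      also have "\<dots> = exp (- 2) / 2 * n powr p2"
        by (simp flip: powr_add)
      also have "\<dots> \<le> norm (A z)"
        using elim(4) z unfolding rh by (auto simp: n_def r_def)
      finally show "fact k * exp 1 * (real K / h) ^ k < norm (A z)" .
    qed
    moreover have "exp (n powr s) \<le> exp (real K) * max_modulus r f"
    proof -
      have "exp (n powr s) \<le> exp (real K + ln m)"
        using K s1 by simp
      also have "\<dots> = exp (real K) * m"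
        using m by (simp add: exp_add)
      also have "\<dots> \<le> exp (real K) * max_modulus r f"
        using mr by simp
      finally show ?thesis .
    qed
    ultimately show ?case
      unfolding rh by (simp add: n_def)
  qed
qed

text \<open>As \<open>M(r, f)\<close> increases with \<open>r\<close>, the bound at one peak
  persists at all larger radii.\<close>

lemma double_log_ge:
  assumes "is_solution k A f" "exp (real (N j) powr s) \<le> max_modulus (1 - 1 / (2 * real (N j))) f"
    and "1 - 1 / (2 * real (N j)) \<le> r" "r < 1"
  shows "s * ln (N j) \<le> log_plus (log_plus (max_modulus r f))"
proof -
  have "0 \<le> 1 - 1 / (2 * real (N j))"
    using N_pos[of j] by (simp add: field_simps)
  then have "exp (real (N j) powr s) \<le> max_modulus r f"
    using max_modulus_mono[OF solution_holomorphic[OF assms(1)]] assms by (meson order.trans)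
  then have "real (N j) powr s \<le> log_plus (max_modulus r f)"
    using log_plus_ge[of "exp (real (N j) powr s)"] by simp
  then have "ln (real (N j) powr s) \<le> log_plus (log_plus (max_modulus r f))"
    using N_pos[of j] by (intro log_plus_ge) auto
  then show ?thesis
    using N_pos[of j] by (simp add: ln_powr)
qed

lemma admissible_exponent:
  assumes k: "1 \<le> k" "real k < p2" and "0 < e"
  obtains s where "0 < s" "(1 + s) * real k < p2" "p2 / real k - 1 - e \<le> s"
proof -
  define g where "g = p2 / real k - 1"
  \<comment> \<open>The entry \<open>g / 2\<close> keeps \<open>s\<close> positive when
    \<open>e \<ge> g\<close>.\<close>
  define s where "s = max (g - e) (g / 2)"
  have "0 < g"
    using k by (simp add: g_def)
  then have "0 < s" "s < g"
    using \<open>0 < e\<close> by (auto simp: s_def)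
  moreover from this have "(1 + s) * real k < p2"
    using k by (simp add: g_def field_simps)
  ultimately show thesis
    using that[of s] by (simp add: s_def g_def)
qed

lemma solution_order_ge:
  assumes k: "1 \<le> k" "real k < p2" and sol: "is_solution k A f" "nontrivial f"
  shows "ereal (p2 / real k - 1) \<le> growth_order f"
  unfolding growth_order_def
proof (rule Limsup_ereal_ge)
  show "filterlim (\<lambda>j. 1 - 1 / (2 * real (N j))) (at_left 1) sequentially"
    by (intro filterlim_one_minus_inverse filterlim_tendsto_pos_mult_at_top[OF tendsto_const _ filterlim_N]) simp
  fix e :: real assume "0 < e"
  then obtain s where s: "0 < s" "(1 + s) * real k < p2" "p2 / real k - 1 - e / 2 \<le> s"
    using admissible_exponent[OF k, of "e / 2"] by auto
  have "(\<lambda>j. (0 + s * ln (N j)) / (ln 2 + 1 * ln (N j))) \<longlonglongrightarrow> s / 1"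
    by (intro affine_ratio_tendsto filterlim_ln_N) auto
  then have "\<forall>\<^sub>F j in sequentially. s - e / 2 < (0 + s * ln (N j)) / (ln 2 + 1 * ln (N j))"
    using \<open>0 < e\<close> by (intro order_tendstoD(1)) auto
  then show "\<forall>\<^sub>F j in sequentially. p2 / real k - 1 - e \<le>
      log_plus (log_plus (max_modulus (1 - 1 / (2 * real (N j))) f)) / ln (1 / (1 - (1 - 1 / (2 * real (N j)))))"
    using solution_growth_at_peaks[OF sol s(1,2)]
  proof eventually_elim
    case (elim j)
    define r where "r = 1 - 1 / (2 * real (N j))"
    have "s * ln (N j) \<le> log_plus (log_plus (max_modulus r f))"
      using elim(2) N_pos[of j] by (intro double_log_ge[OF sol(1)]) (auto simp: r_def)
    moreover have X: "ln (1 / (1 - r)) = ln 2 + ln (N j)"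
      using N_pos[of j] by (simp add: r_def ln_mult)
    moreover have "0 < ln 2 + ln (real (N j))"
      using ln_N_pos[of j] by (simp add: add_pos_pos)
    ultimately have "s * ln (N j) / (ln 2 + ln (N j)) \<le> log_plus (log_plus (max_modulus r f)) / ln (1 / (1 - r))"
      unfolding X by (intro divide_right_mono) auto
    then show ?case
      using elim(1) s(3) unfolding r_def by simp
  qed
qed

text \<open>Between the peak radii of \<open>j\<close> and \<open>j + 1\<close> the numerator is at
  least \<open>s * ln (N j)\<close> and the denominator at most
  \<open>ln 2 + ln (N (Suc j))\<close>; the quotient of these bounds tends to
  \<open>\<kappa> * s\<close>.\<close>

lemma solution_lower_order_ge:
  assumes k: "1 \<le> k" "real k < p2" and sol: "is_solution k A f" "nontrivial f"
    and ratio: "(\<lambda>j. ln (N j) / ln (N (Suc j))) \<longlonglongrightarrow> \<kappa>" and \<kappa>: "0 \<le> \<kappa>" "\<kappa> \<le> 1"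
  shows "ereal (\<kappa> * (p2 / real k - 1)) \<le> lower_growth_order f"
  unfolding lower_growth_order_def
proof (rule Liminf_ereal_ge)
  fix e :: real assume "0 < e"
  then obtain s where s: "0 < s" "(1 + s) * real k < p2" "p2 / real k - 1 - e / 2 \<le> s"
    using admissible_exponent[OF k, of "e / 2"] by auto
  \<comment> \<open>As \<open>\<kappa> \<le> 1\<close>, passing from \<open>p2 / k - 1\<close> to
    \<open>s\<close> loses at most \<open>e / 2\<close>; the other half leaves a strict
    inequality.\<close>
  have "\<kappa> * (p2 / real k - 1 - e / 2) \<le> \<kappa> * s" "\<kappa> * (e / 2) \<le> 1 * (e / 2)"
    using \<kappa> s \<open>0 < e\<close> by (intro mult_left_mono mult_right_mono; simp)+
  then have \<kappa>s: "\<kappa> * (p2 / real k - 1) - e < \<kappa> * s"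
    using \<open>0 < e\<close> right_diff_distrib[of \<kappa> "p2 / real k - 1" "e / 2"] by linarith
  have "(\<lambda>j. ln (N j) / ln (N (Suc j)) * ((0 + s * ln (N (Suc j))) / (ln 2 + 1 * ln (N (Suc j))))) \<longlonglongrightarrow> \<kappa> * (s / 1)"
    by (intro tendsto_mult ratio affine_ratio_tendsto filterlim_ln_N_Suc) auto
  then have "\<forall>\<^sub>F j in sequentially. \<kappa> * (p2 / real k - 1) - e <
      ln (N j) / ln (N (Suc j)) * ((0 + s * ln (N (Suc j))) / (ln 2 + 1 * ln (N (Suc j))))"
    using \<kappa>s by (intro order_tendstoD(1)) auto
  with solution_growth_at_peaks[OF sol s(1,2)]
  have "\<forall>\<^sub>F j in sequentially. exp (real (N j) powr s) \<le> max_modulus (1 - 1 / (2 * real (N j))) f \<and>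
      \<kappa> * (p2 / real k - 1) - e <
      ln (N j) / ln (N (Suc j)) * ((0 + s * ln (N (Suc j))) / (ln 2 + 1 * ln (N (Suc j))))"
    by (rule eventually_conj)
  then obtain J where J: "\<And>j. J \<le> j \<Longrightarrow>
      exp (real (N j) powr s) \<le> max_modulus (1 - 1 / (2 * real (N j))) f"
    "\<And>j. J \<le> j \<Longrightarrow> \<kappa> * (p2 / real k - 1) - e <
      ln (N j) / ln (N (Suc j)) * ((0 + s * ln (N (Suc j))) / (ln 2 + 1 * ln (N (Suc j))))"
    unfolding eventually_sequentially by blast
  have lim: "(\<lambda>j. 1 - 1 / (2 * real (N j))) \<longlonglongrightarrow> 1"
  proof -
    have "filterlim (\<lambda>j. 1 - 1 / (2 * real (N j))) (at_left 1) sequentially"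
      by (intro filterlim_one_minus_inverse filterlim_tendsto_pos_mult_at_top[OF tendsto_const _ filterlim_N]) simp
    then show ?thesis
      by (simp add: filterlim_at)
  qed
  have "1 - 1 / (2 * real (N J)) < 1"
    using N_pos[of J] by simp
  then have "\<forall>\<^sub>F r in at_left 1. r \<in> {1 - 1 / (2 * real (N J))<..<1}"
    by (rule eventually_at_left_real)
  then show "\<forall>\<^sub>F r in at_left 1. \<kappa> * (p2 / real k - 1) - e \<le>
      log_plus (log_plus (max_modulus r f)) / ln (1 / (1 - r))"
  proof eventually_elim
    case (elim r)
    \<comment> \<open>The first peak radius beyond \<open>r\<close>. As \<open>r\<close> exceeds the
      radius of index \<open>J\<close>, \<open>i > J\<close>, so the predecessor \<open>j\<close>
      exists with \<open>j \<ge> J\<close> and its radius is at most \<open>r\<close>.\<close>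
    define i where "i = (LEAST i. r < 1 - 1 / (2 * real (N i)))"
    have "\<exists>i. r < 1 - 1 / (2 * real (N i))"
      using eventually_happens[OF order_tendstoD(1)[OF lim, of r]] elim by auto
    then have i: "r < 1 - 1 / (2 * real (N i))"
      unfolding i_def by (rule LeastI_ex)
    have mono: "1 - 1 / (2 * real (N i)) \<le> 1 - 1 / (2 * real (N i'))" if "i \<le> i'" for i i'
      using N_mono[OF that] N_pos by (simp add: frac_le)
    have "J < i"
      using mono[of i J] i elim by (cases "J < i") auto
    then obtain j where j: "i = Suc j" "J \<le> j"
      by (cases i) auto
    have "1 - 1 / (2 * real (N j)) \<le> r"
      using not_less_Least[of j "\<lambda>i. r < 1 - 1 / (2 * real (N i))"] j unfolding i_def[symmetric] by simp
    then have num: "s * ln (N j) \<le> log_plus (log_plus (max_modulus r f))"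
      using J(1)[OF j(2)] elim by (intro double_log_ge[OF sol(1)]) auto
    let ?n = "real (N (Suc j))"
    have "1 / (1 - r) \<le> 2 * ?n"
      using i j elim N_pos[of "Suc j"] by (simp add: field_simps)
    moreover have "1 - 1 / (2 * real (N j)) > 0"
      using N_pos[of j] by (simp add: field_simps)
    then have "0 < r"
      using \<open>1 - 1 / (2 * real (N j)) \<le> r\<close> by linarith
    ultimately have den: "ln (1 / (1 - r)) \<le> ln 2 + ln ?n" "0 < ln (1 / (1 - r))"
      using elim N_pos[of "Suc j"] ln_mono[of "1 / (1 - r)" "2 * ?n"] by (auto simp: ln_mult)
    have "\<kappa> * (p2 / real k - 1) - e \<le> ln (N j) / ln ?n * ((0 + s * ln ?n) / (ln 2 + 1 * ln ?n))"
      using J(2)[OF j(2)] by simp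
    also have "\<dots> = s * ln (N j) / (ln 2 + ln ?n)"
      using ln_N_pos[of "Suc j"] by simp
    also have "\<dots> \<le> s * ln (N j) / ln (1 / (1 - r))"
      using den s ln_N_pos[of j] by (intro divide_left_mono mult_nonneg_nonneg mult_pos_pos) auto
    also have "\<dots> \<le> log_plus (log_plus (max_modulus r f)) / ln (1 / (1 - r))"
      using num den by (intro divide_right_mono) auto
    finally show ?case .
  qed
qed

end

theorem theorem2:
  fixes k :: nat and p1 p2 \<alpha> :: real
  assumes "k \<ge> 1"
    and "real k \<le> p1" and "p1 < p2" and "2 * real k < p2"
    and "\<alpha> \<in> {p1 / p2 .. 1}"
  shows "\<exists>A. A analytic_on unit_disc \<and>
           growth_degree A = ereal p2 \<and> lower_growth_degree A = ereal p1 \<and>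
           (\<forall>f. is_solution k A f \<and> nontrivial f \<longrightarrow>
              growth_order f = ereal (p2 / real k - 1) \<and>
              lower_growth_order f = ereal (p1 / real k - \<alpha>))"
proof -
  have k: "0 < real k" "real k < p2"
    using assms by auto
  define \<gamma> where "\<gamma> = p2 / real k - 1"
  have \<gamma>: "0 < \<gamma>"
    using k by (simp add: \<gamma>_def)
  \<comment> \<open>The lower order obtained is \<open>\<kappa> * \<gamma>\<close>, which fixes
    \<open>\<kappa>\<close>. Then \<open>\<alpha> \<le> 1 \<le> p1 / k\<close> gives
    \<open>\<kappa> \<ge> 0\<close>, and \<open>\<alpha> \<ge> p1 / p2\<close> gives
    \<open>\<kappa> \<le> p1 / p2\<close>, as \<open>exists_gap_sequence\<close> needs with
    \<open>q = p1 / p2\<close>.\<close>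
  define \<kappa> where "\<kappa> = (p1 / real k - \<alpha>) / \<gamma>"
  have \<kappa>\<gamma>: "\<kappa> * \<gamma> = p1 / real k - \<alpha>"
    using \<gamma> by (simp add: \<kappa>_def)
  have "1 \<le> p1 / real k"
    using k assms by simp
  then have "0 \<le> p1 / real k - \<alpha>"
    using assms(5) by auto
  then have \<kappa>0: "0 \<le> \<kappa>"
    using \<gamma> by (simp add: \<kappa>_def)
  have "p1 / real k - \<alpha> \<le> p1 / real k - p1 / p2"
    using assms by simp
  also have "\<dots> = p1 / p2 * \<gamma>"
    using k by (simp add: \<gamma>_def field_simps)
  finally have \<kappa>_le: "\<kappa> \<le> p1 / p2"
    using \<gamma> by (simp add: \<kappa>_def pos_divide_le_eq)
  have q: "0 < p1 / p2" "p1 / p2 < 1"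
    using k assms by auto
  obtain N :: "nat \<Rightarrow> nat" where N: "\<And>j. 2 \<le> N j" "\<And>j. 2 * N j \<le> N (Suc j)"
    "\<And>j. real (N j) \<le> real (N (Suc j)) powr (p1 / p2)"
    "(\<lambda>j. ln (N j) / ln (N (Suc j))) \<longlonglongrightarrow> \<kappa>"
    by (rule exists_gap_sequence[OF \<kappa>0 \<kappa>_le q]) (rule that)
  interpret gap_coefficient N p1 p2
    using N k assms by unfold_locales auto
  have "growth_order f = ereal \<gamma>" "lower_growth_order f = ereal (\<kappa> * \<gamma>)"
    if f: "is_solution k A f" "nontrivial f" for f
  proof -
    show "growth_order f = ereal \<gamma>"
      unfolding \<gamma>_def using solution_order_le solution_order_ge assms k f by (intro antisym) auto
    \<comment> \<open>This is \<open>\<alpha> \<le> 1\<close> again: the growth due to the singular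
      part does not exceed the target \<open>p1 / k - \<alpha>\<close>.\<close>
    have "p1 / real k - 1 \<le> \<kappa> * (p2 / real k - 1)"
      using \<kappa>\<gamma> assms by (simp add: \<gamma>_def)
    then have "lower_growth_order f \<le> ereal (\<kappa> * \<gamma>)"
      unfolding \<gamma>_def using solution_lower_order_le[OF _ _ f(1) N(4) \<kappa>0] assms by auto
    moreover have "ereal (\<kappa> * \<gamma>) \<le> lower_growth_order f"
      unfolding \<gamma>_def using solution_lower_order_ge[OF _ _ f N(4) \<kappa>0] assms k \<kappa>_le q by auto
    ultimately show "lower_growth_order f = ereal (\<kappa> * \<gamma>)"
      by (rule antisym)
  qed
  then have orders: "growth_order f = ereal (p2 / real k - 1) \<and> lower_growth_order f = ereal (p1 / real k - \<alpha>)"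
    if "is_solution k A f \<and> nontrivial f" for f
    using that unfolding \<kappa>\<gamma> unfolding \<gamma>_def by simp
  show ?thesis
    by (intro exI[of _ A] conjI[OF A_analytic] conjI[OF growth_degree_A] conjI[OF lower_growth_degree_A]
        allI impI orders)
qed

end
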